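(* Let $\mathcal{X}\subset\mathbb{R}^d$, $A\subset\mathbb{R}^m$ be finite (nonempty), $r:\mathcal{X}\times A\times\mathcal{X}\to\mathbb{R}$, $\alpha\in(0,1)$. For each $(x,a)\in\mathcal{X}\times A$ let $\Theta(x,a)\subset\mathbb{R}^{d_\theta}$ be nonempty and compact, and let $\Theta(x,a)\ni\theta\mapsto\widehat{\mathbb{P}}(x,a,\theta)\in\mathcal{M}_1(\mathcal{X})$ be continuous in the Wasserstein-1 topology. Set $\mathcal{P}^{\Theta}(x,a)=\{\widehat{\mathbb{P}}(x,a,\theta) : \theta\in\Theta(x,a)\}$. Then for every $n\in\mathbb{N}$ there exists a set-valued map $\mathcal{X}\times A\ni(x,a)\twoheadrightarrow\Theta^{(n)}(x,a)\subset\Theta(x,a)$ with finitely many elements such that, with $$\mathcal{P}^{(n)}(x,a)=\{\widehat{\mathbb{P}}(x,a,\theta) : \theta\in\Theta^{(n)}(x,a)\},$$ the following hold. (a) The set-valued map $(x,a)\twoheadrightarrow\mathcal{P}^\Theta(x,a)$ is nonempty, compact-valued and continuous (upper and lower hemicontinuous) in the weak topology, and for all $(x,a)\in\mathcal{X}\times A$ and all $\mathbb{P}\in\mathcal{P}^\Theta(x,a)$ there exists a sequence $(\mathbb{P}^{(n)})_{n}$ with $\mathbb{P}^{(n)}\in\mathcal{P}^{(n)}(x,a)\subset\mathcal{P}^{\Theta}(x,a)$ for all $n$, $\mathbb{P}^{(n)}\to\mathbb{P}$ weakly, and $\int_{\mathcal{X}}|x|\,d\mathbb{P}^{(n)}(x)\to\int_{\mathcal{X}}|x|\,d\mathbb{P}(x)$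 as $n\to\infty$. (b) With $V$ and $V^{(n)}$ the robust value functions associated with $\mathcal{P}^\Theta$ and $\mathcal{P}^{(n)}$, respectively, for all $(x,a)\in\mathcal{X}\times A$, $$\lim_{n\to\infty}\ \inf_{\mathbb{P}\in\mathcal{P}^{(n)}(x,a)}\mathbb{E}_{\mathbb{P}}[r(x,a,X_1)+\alpha V^{(n)}(X_1)]=\inf_{\mathbb{P}\in\mathcal{P}^{\Theta}(x,a)}\mathbb{E}_{\mathbb{P}}[r(x,a,X_1)+\alpha V(X_1)].$$
   Context: $\mathcal{M}_1(\mathcal{X})$ is the set of probability measures on $\mathcal{X}$; $|x|$ is the Euclidean norm. For an ambiguity set $\mathcal{R}$, i.e. an assignment $(x,a)\mapsto\mathcal{R}(x,a)\subseteq\mathcal{M}_1(\mathcal{X})$, the associated robust value function is $$V^{\mathcal{R}}(x)=\sup_{\mathbf{a}\in\mathcal{A}}\inf_{\mathbb{P}\in\mathfrak{P}_{x,\mathbf{a}}}\mathbb{E}_{\mathbb{P}}\Big[\sum_{t=0}^\infty\alpha^tr(X_t,a_t(X_t),X_{t+1})\Big],\qquad x\in\mathcal{X},$$ where $\mathcal{A}$ is the set of policies $\mathbf{a}=(a_t)_{t\ge0}$ with $a_t:\mathcal{X}\to A$, and $\mathfrak{P}_{x,\mathbf{a}}$ is the set of laws $\delta_x\otimes\mathbb{P}_0\otimes\mathbb{P}_1\otimes\cdots$ of processes $(X_t)_{t\ge0}$ on $\mathcal{X}$ ($X_0=x$, and $X_{t+1}$ has conditional law $\mathbb{P}_t(X_t)$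 given $X_0,\dots,X_t$) with kernels $\mathbb{P}_t:\mathcal{X}\to\mathcal{M}_1(\mathcal{X})$ satisfying $\mathbb{P}_t(x_t)\in\mathcal{R}(x_t,a_t(x_t))$ for all $x_t\in\mathcal{X}$, $t\ge0$. In $\mathbb{E}_{\mathbb{P}}[\,\cdot\,]$ with $\mathbb{P}\in\mathcal{M}_1(\mathcal{X})$, $X_1$ has law $\mathbb{P}$. *)

theory Defs
  imports "HOL-Probability.Probability"
begin

section \<open>Probability measures on a subset of a metric space\<close>

abbreviation borel_on :: "'a::topological_space set \<Rightarrow> 'a measure" where
  "borel_on X \<equiv> restrict_space borel X"

definition prob_measures :: "'a::topological_space set \<Rightarrow> 'a measure set" where
  "prob_measures X = space (prob_algebra (borel_on X))"

lemma prob_measures_iff: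
  "P \<in> prob_measures X \<longleftrightarrow> prob_space P \<and> sets P = sets (borel_on X)"
  by (auto simp: prob_measures_def space_prob_algebra)

text \<open>The coarsest topology on the probability measures on \<open>X\<close> for which
  \<open>P \<mapsto> \<integral>f dP\<close> is continuous for every bounded continuous \<open>f : X \<rightarrow> \<real>\<close>.\<close>

definition weak_topology :: "'a::topological_space set \<Rightarrow> 'a measure topology" where
  "weak_topology X = topology_generated_by
     {{P \<in> prob_measures X. (\<integral>y. f y \<partial>P) \<in> U} | (f :: 'a \<Rightarrow> real) U.
        continuous_on X f \<and> bounded (f ` X) \<and> open U}"

definition couplings :: "'a::topological_space set \<Rightarrow> 'a measure \<Rightarrow> 'a measure \<Rightarrow> ('a \<times> 'a) measure set" where
  "couplings X P Q = {\<pi> \<in> space (prob_algebra (borel_on X \<Otimes>\<^sub>M borel_on X)).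
     distr \<pi> (borel_on X) fst = P \<and> distr \<pi> (borel_on X) snd = Q}"

text \<open>For bounded \<open>X\<close> (here \<open>X\<close> is finite) every probability measure on \<open>X\<close> has a finite first
  moment and all integrals below are finite, so the infimum can be taken in the reals.\<close>

definition wasserstein1 :: "'a::metric_space set \<Rightarrow> 'a measure \<Rightarrow> 'a measure \<Rightarrow> real" where
  "wasserstein1 X P Q = (INF \<pi>\<in>couplings X P Q. \<integral>z. dist (fst z) (snd z) \<partial>\<pi>)"

definition wasserstein1_topology :: "'a::metric_space set \<Rightarrow> 'a measure topology" where
  "wasserstein1_topology X = topology (\<lambda>U. U \<subseteq> prob_measures X \<and>
     (\<forall>P\<in>U. \<exists>e>0. \<forall>Q\<in>prob_measures X. wasserstein1 X P Q < e \<longrightarrow> Q \<in> U))"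

lemma openin_wasserstein1_topology:
  "openin (wasserstein1_topology X) U \<longleftrightarrow> U \<subseteq> prob_measures X \<and>
     (\<forall>P\<in>U. \<exists>e>0. \<forall>Q\<in>prob_measures X. wasserstein1 X P Q < e \<longrightarrow> Q \<in> U)"
proof -
  define op where "op U \<longleftrightarrow> U \<subseteq> prob_measures X \<and>
     (\<forall>P\<in>U. \<exists>e>0. \<forall>Q\<in>prob_measures X. wasserstein1 X P Q < e \<longrightarrow> Q \<in> U)" for U
  have "istopology op"
    unfolding istopology_def
  proof safe
    fix S T assume S: "op S" and T: "op T"
    show "op (S \<inter> T)"
      unfolding op_def
    proof (intro conjI ballI)
      show "S \<inter> T \<subseteq> prob_measures X" using S by (auto simp: op_def)
      fix P assume "P \<in> S \<inter> T"
      then obtain e d where "e > 0" "\<forall>Q\<in>prob_measures X. wasserstein1 X P Q < e \<longrightarrow> Q \<in> S"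
        and "d > 0" "\<forall>Q\<in>prob_measures X. wasserstein1 X P Q < d \<longrightarrow> Q \<in> T"
        using S T by (auto simp: op_def) blast
      then show "\<exists>e>0. \<forall>Q\<in>prob_measures X. wasserstein1 X P Q < e \<longrightarrow> Q \<in> S \<inter> T"
        by (intro exI[of _ "min e d"]) auto
    qed
  next
    fix \<K> assume "\<forall>K\<in>\<K>. op K"
    then show "op (\<Union>\<K>)"
      unfolding op_def by (meson Sup_least UnionE UnionI)
  qed
  then show ?thesis
    unfolding wasserstein1_topology_def op_def[abs_def] by (simp add: topology_inverse')
qed


section \<open>Hemicontinuity of set-valued maps\<close>

definition upper_hemicontinuous_map :: "'a topology \<Rightarrow> 'b topology \<Rightarrow> ('a \<Rightarrow> 'b set) \<Rightarrow> bool" where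
  "upper_hemicontinuous_map S T F \<longleftrightarrow>
     (\<forall>z\<in>topspace S. F z \<subseteq> topspace T) \<and>
     (\<forall>V. openin T V \<longrightarrow> openin S {z \<in> topspace S. F z \<subseteq> V})"

definition lower_hemicontinuous_map :: "'a topology \<Rightarrow> 'b topology \<Rightarrow> ('a \<Rightarrow> 'b set) \<Rightarrow> bool" where
  "lower_hemicontinuous_map S T F \<longleftrightarrow>
     (\<forall>z\<in>topspace S. F z \<subseteq> topspace T) \<and>
     (\<forall>V. openin T V \<longrightarrow> openin S {z \<in> topspace S. F z \<inter> V \<noteq> {}})"


section \<open>Robust value functions\<close>

text \<open>The law \<open>\<delta>\<^sub>x \<otimes> \<kappa>\<^sub>0 \<otimes> \<kappa>\<^sub>1 \<otimes> \<dots>\<close> on the path space, as an Ionescu-Tulcea limit. In the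
  library's indexing the \<open>i\<close>-th kernel yields the law of coordinate \<open>i\<close> given coordinates
  \<open>0, \<dots>, i - 1\<close>, so \<open>\<kappa> t\<close> sits at position \<open>Suc t\<close>.\<close>

fun step_kernel ::
  "'a::topological_space set \<Rightarrow> 'a \<Rightarrow> (nat \<Rightarrow> 'a \<Rightarrow> 'a measure) \<Rightarrow> nat \<Rightarrow> (nat \<Rightarrow> 'a) \<Rightarrow> 'a measure" where
  "step_kernel X x \<kappa> 0 \<omega> = return (borel_on X) x"
| "step_kernel X x \<kappa> (Suc t) \<omega> = \<kappa> t (\<omega> t)"

definition path_law ::
  "'a::topological_space set \<Rightarrow> 'a \<Rightarrow> (nat \<Rightarrow> 'a \<Rightarrow> 'a measure) \<Rightarrow> (nat \<Rightarrow> 'a) measure" where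
  "path_law X x \<kappa> = projective_family.lim UNIV
     (Ionescu_Tulcea.CI (step_kernel X x \<kappa>) (\<lambda>_. borel_on X)) (\<lambda>_. borel_on X)"

lemma sets_borel_on_finite:
  fixes X :: "'a::t1_space set"
  assumes "finite X"
  shows "sets (borel_on X) = Pow X"
proof -
  have "B \<in> sets borel" if "B \<subseteq> X" for B
    using that assms by (meson borel_closed finite_imp_closed finite_subset)
  then show ?thesis
    by (auto simp: sets_restrict_space image_iff)
qed

text \<open>On a finite state space all kernels are measurable, so the law above is well defined.\<close>

lemma Ionescu_Tulcea_step_kernel:
  fixes X :: "'a::t1_space set"
  assumes "finite X" "x \<in> X" "\<And>t y. y \<in> X \<Longrightarrow> \<kappa> t y \<in> prob_measures X"
  shows "Ionescu_Tulcea (step_kernel X x \<kappa>) (\<lambda>_. borel_on X)"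
proof -
  have sp: "space (borel_on X) = X" by (simp add: space_restrict_space)
  have eq: "sets (borel_on X) = sets (count_space X)"
    using sets_borel_on_finite[OF assms(1)] by simp
  have 1: "step_kernel X x \<kappa> i \<in> measurable (PiM {0..<i} (\<lambda>_. borel_on X)) (subprob_algebra (borel_on X))" for i
  proof (cases i)
    case 0
    have "return (borel_on X) x \<in> space (subprob_algebra (borel_on X))"
      using assms(2) sp
      by (auto simp: space_subprob_algebra intro!: prob_space_return prob_space_imp_subprob_space)
    moreover have "step_kernel X x \<kappa> 0 = (\<lambda>_. return (borel_on X) x)"
      by (simp add: fun_eq_iff)
    ultimately show ?thesis using 0 by simp
  next
    case (Suc t)
    have "\<kappa> t \<in> measurable (borel_on X) (subprob_algebra (borel_on X))"
      using assms(3)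
      by (subst measurable_cong_sets[OF eq refl])
         (auto simp: prob_measures_iff space_subprob_algebra intro: prob_space_imp_subprob_space)
    then have "(\<lambda>\<omega>. \<kappa> t (\<omega> t)) \<in> measurable (PiM {0..<i} (\<lambda>_. borel_on X)) (subprob_algebra (borel_on X))"
      by (rule measurable_compose[rotated]) (simp add: Suc measurable_component_singleton)
    moreover have "step_kernel X x \<kappa> i = (\<lambda>\<omega>. \<kappa> t (\<omega> t))"
      by (simp add: fun_eq_iff Suc)
    ultimately show ?thesis by simp
  qed
  have 2: "prob_space (step_kernel X x \<kappa> i \<omega>)"
    if "\<omega> \<in> space (PiM {0..<i} (\<lambda>_. borel_on X))" for i \<omega>
  proof (cases i)
    case 0
    then show ?thesis using assms(2) sp by (auto intro!: prob_space_return)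
  next
    case (Suc t)
    then have "\<omega> t \<in> X" using that sp by (auto simp: space_PiM PiE_iff)
    then show ?thesis using assms(3) Suc by (auto simp: prob_measures_iff)
  qed
  show ?thesis
    using 1 2 by (rule Ionescu_Tulcea.intro)
qed

text \<open>Measurability of policies and kernels is not required: it is automatic on a finite state
  space.\<close>

definition path_laws ::
  "'x::topological_space set \<Rightarrow> ('x \<Rightarrow> 'a \<Rightarrow> 'x measure set) \<Rightarrow> 'x \<Rightarrow> (nat \<Rightarrow> 'x \<Rightarrow> 'a) \<Rightarrow>
   (nat \<Rightarrow> 'x) measure set" where
  "path_laws X R x a = {path_law X x \<kappa> | \<kappa>. \<forall>t. \<forall>y\<in>X. \<kappa> t y \<in> R y (a t y)}"

text \<open>For a nonempty-valued ambiguity set \<open>R\<close>, finite \<open>X\<close> and \<open>A\<close>, and \<open>0 < \<alpha> < 1\<close>, the discounted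
  rewards are bounded by \<open>max \<bar>r\<bar> / (1 - \<alpha>)\<close>, so real-valued suprema and infima suffice.\<close>

definition robust_value ::
  "'x::topological_space set \<Rightarrow> 'a set \<Rightarrow> ('x \<Rightarrow> 'a \<Rightarrow> 'x \<Rightarrow> real) \<Rightarrow> real \<Rightarrow>
   ('x \<Rightarrow> 'a \<Rightarrow> 'x measure set) \<Rightarrow> 'x \<Rightarrow> real" where
  "robust_value X A r \<alpha> R x =
     (SUP a \<in> {a. \<forall>t::nat. a t \<in> X \<rightarrow> A}. INF Q \<in> path_laws X R x a.
        \<integral>\<omega>. (\<Sum>t. \<alpha> ^ t * r (\<omega> t) (a t (\<omega> t)) (\<omega> (Suc t))) \<partial>Q)"

definition param_ambiguity ::
  "('x \<Rightarrow> 'a \<Rightarrow> 'p \<Rightarrow> 'x measure) \<Rightarrow> ('x \<Rightarrow> 'a \<Rightarrow> 'p set) \<Rightarrow> 'x \<Rightarrow> 'a \<Rightarrow> 'x measure set" where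
  "param_ambiguity Phat \<Theta> x a = {Phat x a \<theta> | \<theta>. \<theta> \<in> \<Theta> x a}"

end

theory Submission
  imports Defs
begin

text \<open>On a finite state space all relevant topologies on probability measures reduce to the point
  masses, so by compactness each \<open>\<P>\<^sup>\<Theta>(x, a)\<close> has a finite \<open>1/(n+1)\<close>-net in the \<open>\<ell>\<^sup>1\<close>-distance of point
  masses; this net is \<open>\<P>\<^sup>(\<^sup>n\<^sup>)(x, a)\<close>. Replacing every kernel of a Markov chain by one at \<open>\<ell>\<^sup>1\<close>-distance at
  most \<open>\<eta>\<close> moves the joint law of \<open>(X\<^sub>t, X\<^sub>t\<^sub>+\<^sub>1)\<close> by at most \<open>(t + 1) \<eta>\<close>, hence the expected discounted
  reward by at most \<open>\<Sum>t. \<alpha>\<^sup>t M (t + 1) \<eta> = M \<eta> / (1 - \<alpha>)\<^sup>2\<close>, uniformly in the policy and the kernels.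
  Therefore \<open>V \<le> V\<^sup>(\<^sup>n\<^sup>) \<le> V + O(1/n)\<close>, with no appeal to dynamic programming.\<close>

section \<open>Point masses on a finite state space\<close>

text \<open>On the space, \<open>g (Y \<omega>)\<close> agrees with a simple function built from the
  level sets of \<open>Y\<close>, so only these sets have to be measurable. The same formula serves
  single states, pairs under a coupling, and consecutive coordinates of a path.\<close>

lemma (in finite_measure) integral_finite_range:
  fixes g :: "'b \<Rightarrow> real"
  assumes "finite S" "\<And>\<omega>. \<omega> \<in> space M \<Longrightarrow> Y \<omega> \<in> S"
    and ms: "\<And>s. s \<in> S \<Longrightarrow> {\<omega> \<in> space M. Y \<omega> = s} \<in> sets M"
  shows "(\<integral>\<omega>. g (Y \<omega>) \<partial>M) = (\<Sum>s\<in>S. g s * measure M {\<omega> \<in> space M. Y \<omega> = s})"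
    and "integrable M (\<lambda>\<omega>. g (Y \<omega>))"
proof -
  let ?h = "\<lambda>\<omega>. \<Sum>s\<in>S. g s * indicator {\<omega> \<in> space M. Y \<omega> = s} \<omega>"
  have eq: "g (Y \<omega>) = ?h \<omega>" if "\<omega> \<in> space M" for \<omega>
    using that assms(1,2) by (simp add: indicator_def sum.delta' if_distrib cong: if_cong)
  have int: "integrable M (indicator {\<omega> \<in> space M. Y \<omega> = s} :: _ \<Rightarrow> real)" if "s \<in> S" for s
    using ms[OF that] by (simp add: emeasure_eq_measure)
  have "(\<integral>\<omega>. g (Y \<omega>) \<partial>M) = (\<integral>\<omega>. ?h \<omega> \<partial>M)"
    by (intro Bochner_Integration.integral_cong eq) auto
  also have "\<dots> = (\<Sum>s\<in>S. g s * measure M {\<omega> \<in> space M. Y \<omega> = s})"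
    using int ms by (subst Bochner_Integration.integral_sum) (auto intro!: sum.cong)
  finally show "(\<integral>\<omega>. g (Y \<omega>) \<partial>M) = (\<Sum>s\<in>S. g s * measure M {\<omega> \<in> space M. Y \<omega> = s})" .
  have "integrable M ?h"
    using int by (intro Bochner_Integration.integrable_sum integrable_mult_right) auto
  then show "integrable M (\<lambda>\<omega>. g (Y \<omega>))"
    by (subst Bochner_Integration.integrable_cong[OF refl eq])
qed

text \<open>For probability measures on a finite \<open>X\<close> this is twice the total variation
  distance.\<close>

definition l1_dist :: "'a set \<Rightarrow> 'a measure \<Rightarrow> 'a measure \<Rightarrow> real" where
  "l1_dist X P Q = (\<Sum>y\<in>X. \<bar>measure P {y} - measure Q {y}\<bar>)"

lemma space_prob_measures: "P \<in> prob_measures X \<Longrightarrow> space P = X"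
  using sets_eq_imp_space_eq[of P "borel_on X"]
  by (simp add: prob_measures_iff space_restrict_space)

lemma sets_prob_measures_finite:
  fixes X :: "'a::t1_space set"
  shows "finite X \<Longrightarrow> P \<in> prob_measures X \<Longrightarrow> sets P = Pow X"
  by (simp add: prob_measures_iff sets_borel_on_finite)

lemma integral_prob_measures:
  fixes X :: "'a::t1_space set" and f :: "'a \<Rightarrow> real"
  assumes "finite X" "P \<in> prob_measures X"
  shows "(\<integral>y. f y \<partial>P) = (\<Sum>y\<in>X. f y * measure P {y})"
proof -
  interpret prob_space P using assms by (simp add: prob_measures_iff)
  note sp = space_prob_measures[OF assms(2)] and st = sets_prob_measures_finite[OF assms]
  have "{\<omega> \<in> X. \<omega> = s} = {s}" if "s \<in> X" for s using that by auto
  then show ?thesis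
    using integral_finite_range(1)[of X "\<lambda>y. y" f] assms(1) by (auto simp: sp st)
qed

lemma sum_measure_prob_measures:
  fixes X :: "'a::t1_space set"
  assumes "finite X" "P \<in> prob_measures X"
  shows "(\<Sum>y\<in>X. measure P {y}) = 1"
proof -
  interpret prob_space P using assms by (simp add: prob_measures_iff)
  show ?thesis
    using integral_prob_measures[OF assms, of "\<lambda>_. 1"] prob_space by simp
qed

lemma abs_integral_diff_le_l1_dist:
  fixes X :: "'a::t1_space set" and f :: "'a \<Rightarrow> real"
  assumes "finite X" "P \<in> prob_measures X" "Q \<in> prob_measures X"
    and M: "\<And>y. y \<in> X \<Longrightarrow> \<bar>f y\<bar> \<le> M"
  shows "\<bar>(\<integral>y. f y \<partial>P) - (\<integral>y. f y \<partial>Q)\<bar> \<le> M * l1_dist X P Q"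
proof -
  have "(\<integral>y. f y \<partial>P) - (\<integral>y. f y \<partial>Q) = (\<Sum>y\<in>X. f y * (measure P {y} - measure Q {y}))"
    using assms by (simp add: integral_prob_measures right_diff_distrib sum_subtractf)
  also have "\<bar>\<dots>\<bar> \<le> (\<Sum>y\<in>X. \<bar>f y * (measure P {y} - measure Q {y})\<bar>)"
    by (rule sum_abs)
  also have "\<dots> \<le> (\<Sum>y\<in>X. M * \<bar>measure P {y} - measure Q {y}\<bar>)"
    using M by (intro sum_mono) (auto simp: abs_mult intro!: mult_right_mono)
  finally show ?thesis by (simp add: l1_dist_def sum_distrib_left)
qed

section \<open>Couplings and the Wasserstein-1 topology\<close>

lemma couplings_nonempty:
  assumes "P \<in> prob_measures X" "Q \<in> prob_measures X"
  shows "couplings X P Q \<noteq> {}"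
proof -
  interpret P: prob_space P using assms by (simp add: prob_measures_iff)
  interpret Q: prob_space Q using assms by (simp add: prob_measures_iff)
  interpret PQ: pair_prob_space P Q ..
  have s: "sets P = sets (borel_on X)" "sets Q = sets (borel_on X)"
    using assms by (auto simp: prob_measures_iff)
  have "distr (P \<Otimes>\<^sub>M Q) (borel_on X) fst = distr (P \<Otimes>\<^sub>M Q) P fst"
    by (rule distr_cong) (auto simp: s)
  moreover have "distr (P \<Otimes>\<^sub>M Q) (borel_on X) snd = distr (P \<Otimes>\<^sub>M Q) Q snd"
    by (rule distr_cong) (auto simp: s)
  moreover have "distr (P \<Otimes>\<^sub>M Q) Q snd = Q"
  proof (rule measure_eqI)
    fix B assume "B \<in> sets (distr (P \<Otimes>\<^sub>M Q) Q snd)"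
    then have B: "B \<in> sets Q" by simp
    then have "snd -` B \<inter> space (P \<Otimes>\<^sub>M Q) = space P \<times> B"
      using sets.sets_into_space[OF B] by (auto simp: space_pair_measure)
    then show "emeasure (distr (P \<Otimes>\<^sub>M Q) Q snd) B = emeasure Q B"
      using B by (simp add: emeasure_distr Q.emeasure_pair_measure_Times P.emeasure_space_1)
  qed simp
  ultimately have "P \<Otimes>\<^sub>M Q \<in> couplings X P Q"
    using Q.distr_pair_fst[of P] PQ.prob_space_axioms
    by (auto simp: couplings_def space_prob_algebra s intro!: sets_pair_measure_cong)
  then show ?thesis by auto
qed

lemma finite_separation:
  fixes X :: "'a::metric_space set"
  assumes "finite X"
  obtains \<delta> where "\<delta> > 0" "\<And>y z. y \<in> X \<Longrightarrow> z \<in> X \<Longrightarrow> y \<noteq> z \<Longrightarrow> \<delta> \<le> dist y z"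
proof
  \<comment> \<open>The extra element 1 keeps the minimum defined when \<open>X\<close> has at most
    one point.\<close>
  let ?D = "insert 1 ((\<lambda>(y, z). dist y z) ` {(y, z) \<in> X \<times> X. y \<noteq> z})"
  have fin: "finite ?D" using assms
    by (intro finite.insertI finite_imageI) (auto intro: finite_subset[of _ "X \<times> X"])
  show "Min ?D > 0" by (subst Min_gr_iff[OF fin]) auto
  show "Min ?D \<le> dist y z" if "y \<in> X" "z \<in> X" "y \<noteq> z" for y z
    using that by (intro Min_le[OF fin]) force
qed

text \<open>A coupling can realise a mass difference at \<open>x\<close> only on pairs with distinct
  coordinates, and each such pair costs at least \<open>\<delta>\<close>. Integrating this over an
  arbitrary coupling and taking the infimum gives the bound.\<close>

lemma point_mass_diff_le_wasserstein1:
  fixes X :: "'a::metric_space set"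
  assumes fin: "finite X" and P: "P \<in> prob_measures X" and Q: "Q \<in> prob_measures X"
    and \<delta>: "\<delta> > 0" "\<And>y z. y \<in> X \<Longrightarrow> z \<in> X \<Longrightarrow> y \<noteq> z \<Longrightarrow> \<delta> \<le> dist y z"
    and x: "x \<in> X"
  shows "\<delta> * \<bar>measure P {x} - measure Q {x}\<bar> \<le> wasserstein1 X P Q"
  unfolding wasserstein1_def
\<comment> \<open>A lower bound for a real infimum requires a nonempty set; the product measure
  supplies a coupling.\<close>
proof (rule cINF_greatest[OF couplings_nonempty[OF P Q]])
  fix \<pi> assume "\<pi> \<in> couplings X P Q"
  then have \<pi>: "prob_space \<pi>" "sets \<pi> = sets (borel_on X \<Otimes>\<^sub>M borel_on X)"
    and d: "P = distr \<pi> (borel_on X) fst" "Q = distr \<pi> (borel_on X) snd"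
    by (auto simp: couplings_def space_prob_algebra)
  interpret prob_space \<pi> by fact
  have sp: "space \<pi> = X \<times> X"
    using sets_eq_imp_space_eq[OF \<pi>(2)] by (simp add: space_pair_measure space_restrict_space)
  have [measurable]: "fst \<in> measurable \<pi> (borel_on X)" "snd \<in> measurable \<pi> (borel_on X)"
    unfolding measurable_cong_sets[OF \<pi>(2) refl] by auto
  have single: "{s} \<in> sets (borel_on X)" if "s \<in> X" for s
    using fin that by (simp add: sets_borel_on_finite)
  have ms: "{\<omega> \<in> space \<pi>. \<omega> = s} \<in> sets \<pi>" if "s \<in> X \<times> X" for s
  proof -
    have "{fst s} \<times> {snd s} \<in> sets \<pi>"
      unfolding \<pi>(2) using that by (intro pair_measureI single) auto
    moreover have "{\<omega> \<in> space \<pi>. \<omega> = s} = {fst s} \<times> {snd s}" using that sp by auto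
    ultimately show ?thesis by simp
  qed
  \<comment> \<open>All points of the finite set \<open>X \<times> X\<close> are measurable, hence
    every real function on it is integrable, the distance included.\<close>
  have int: "integrable \<pi> g" for g :: "_ \<Rightarrow> real"
    using integral_finite_range(2)[of "X \<times> X" "\<lambda>z. z" g] fin ms sp by auto
  have e1: "measure P {x} = (\<integral>z. indicator {x} (fst z) \<partial>\<pi>)"
    unfolding d using single[OF x]
    by (subst integral_distr[symmetric, where g=fst and N="borel_on X"]) auto
  have e2: "measure Q {x} = (\<integral>z. indicator {x} (snd z) \<partial>\<pi>)"
    unfolding d using single[OF x]
    by (subst integral_distr[symmetric, where g=snd and N="borel_on X"]) auto
  have "measure P {x} - measure Q {x} = (\<integral>z. indicator {x} (fst z) - indicator {x} (snd z) \<partial>\<pi>)"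
    unfolding e1 e2 by (rule Bochner_Integration.integral_diff[symmetric]) (rule int)+
  also have "\<bar>\<dots>\<bar> \<le> (\<integral>z. \<bar>indicator {x} (fst z) - indicator {x} (snd z)\<bar> \<partial>\<pi>)"
    by (rule integral_abs_bound)
  finally have "\<delta> * \<bar>measure P {x} - measure Q {x}\<bar> \<le> (\<integral>z. \<delta> * \<bar>indicator {x} (fst z) - indicator {x} (snd z)\<bar> \<partial>\<pi>)"
    using \<delta>(1) by simp
  also have "\<dots> \<le> (\<integral>z. dist (fst z) (snd z) \<partial>\<pi>)"
    using \<delta> by (intro integral_mono int) (auto simp: sp indicator_def)
  finally show "\<delta> * \<bar>measure P {x} - measure Q {x}\<bar> \<le> (\<integral>z. dist (fst z) (snd z) \<partial>\<pi>)" .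
qed

lemma topspace_wasserstein1_topology: "topspace (wasserstein1_topology X) = prob_measures X"
proof -
  have "openin (wasserstein1_topology X) (prob_measures X)"
    by (auto simp: openin_wasserstein1_topology intro: exI[of _ 1])
  then show ?thesis
    by (metis openin_subset openin_topspace openin_wasserstein1_topology subset_antisym)
qed

text \<open>Turns Wasserstein continuity into continuity of finitely many real functions. By the
  separation bound, the Wasserstein ball of radius \<open>\<delta> * e\<close> around
  \<open>P\<close> changes the mass at \<open>x\<close> by less than \<open>e\<close>.\<close>

lemma continuous_map_point_mass:
  fixes X :: "'a::metric_space set"
  assumes fin: "finite X" and x: "x \<in> X"
  shows "continuous_map (wasserstein1_topology X) euclideanreal (\<lambda>P. measure P {x})"
proof -
  obtain \<delta> where \<delta>: "\<delta> > 0" "\<And>y z. y \<in> X \<Longrightarrow> z \<in> X \<Longrightarrow> y \<noteq> z \<Longrightarrow> \<delta> \<le> dist y z"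
    using finite_separation[OF fin] by blast
  show ?thesis
    unfolding continuous_map topspace_wasserstein1_topology
  proof (intro conjI allI impI)
    fix U :: "real set" assume "openin euclidean U"
    then have U: "open U" by simp
    show "openin (wasserstein1_topology X) {P \<in> prob_measures X. measure P {x} \<in> U}"
      unfolding openin_wasserstein1_topology
    proof (intro conjI ballI)
      fix P assume P: "P \<in> {P \<in> prob_measures X. measure P {x} \<in> U}"
      then obtain e where e: "e > 0" "\<And>u. dist u (measure P {x}) < e \<Longrightarrow> u \<in> U"
        using U by (auto simp: open_dist)
      have "measure Q {x} \<in> U" if Q: "Q \<in> prob_measures X" "wasserstein1 X P Q < \<delta> * e" for Q
      proof (rule e(2))
        have "\<delta> * \<bar>measure P {x} - measure Q {x}\<bar> < \<delta> * e"
          using point_mass_diff_le_wasserstein1[OF fin _ Q(1) \<delta> x, of P] P Q(2) by auto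
        then show "dist (measure Q {x}) (measure P {x}) < e"
          using \<delta>(1) by (simp add: dist_real_def abs_minus_commute)
      qed
      then show "\<exists>e>0. \<forall>Q\<in>prob_measures X. wasserstein1 X P Q < e \<longrightarrow>
          Q \<in> {P \<in> prob_measures X. measure P {x} \<in> U}"
        using \<delta>(1) e(1) by (intro exI[of _ "\<delta> * e"]) auto
    qed auto
  qed auto
qed

section \<open>The weak topology in terms of point masses\<close>

lemma topspace_weak_topology:
  "topspace (weak_topology (X :: 'a::topological_space set)) = prob_measures X"
proof -
  let ?S = "{{P \<in> prob_measures X. (\<integral>y. f y \<partial>P) \<in> U} | (f :: 'a \<Rightarrow> real) U.
        continuous_on X f \<and> bounded (f ` X) \<and> open U}"
  \<comment> \<open>The zero function with \<open>U = UNIV\<close> exhibits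
    \<open>prob_measures X\<close> itself as a subbasic set, so the union of the subbasis is the
    whole set.\<close>
  have "bounded ((\<lambda>_. 0 :: real) ` X)"
    by (rule bounded_subset[of "{0}"]) auto
  then have "{P \<in> prob_measures X. (\<integral>y. (0::real) \<partial>P) \<in> UNIV} \<in> ?S"
    using continuous_on_const open_UNIV by blast
  then have "prob_measures X \<in> ?S" by simp
  moreover have "\<And>W. W \<in> ?S \<Longrightarrow> W \<subseteq> prob_measures X" by blast
  ultimately have "\<Union>?S = prob_measures X" by (metis (no_types, lifting) Sup_least Sup_upper subset_antisym)
  then show ?thesis
    unfolding weak_topology_def topology_generated_by_topspace .
qed

text \<open>Integrals of test functions are finite linear combinations of point masses, so preimages
  of subbasic sets are open.\<close>

lemma continuous_map_weak_topology:
  fixes X :: "'a::t1_space set"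
  assumes fin: "finite X" and p: "\<And>t. t \<in> topspace T \<Longrightarrow> p t \<in> prob_measures X"
    and c: "\<And>x. x \<in> X \<Longrightarrow> continuous_map T euclideanreal (\<lambda>t. measure (p t) {x})"
  shows "continuous_map T (weak_topology X) p"
  unfolding weak_topology_def continuous_on_generated_topo_iff
proof (intro conjI allI impI)
  show "p ` topspace T \<subseteq> \<Union>{{P \<in> prob_measures X. (\<integral>y. f y \<partial>P) \<in> U} | (f :: 'a \<Rightarrow> real) U.
        continuous_on X f \<and> bounded (f ` X) \<and> open U}"
    using p topspace_weak_topology[of X]
    unfolding weak_topology_def topology_generated_by_topspace by auto
  fix W assume "W \<in> {{P \<in> prob_measures X. (\<integral>y. f y \<partial>P) \<in> U} | (f :: 'a \<Rightarrow> real) U.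
        continuous_on X f \<and> bounded (f ` X) \<and> open U}"
  then obtain f :: "'a \<Rightarrow> real" and U where
    W: "W = {P \<in> prob_measures X. (\<integral>y. f y \<partial>P) \<in> U}" and U: "open U" by blast
  have "continuous_map T euclideanreal (\<lambda>t. \<Sum>x\<in>X. f x * measure (p t) {x})"
    using c fin by (intro continuous_map_sum continuous_map_real_mult) auto
  then have "openin T {t \<in> topspace T. (\<Sum>x\<in>X. f x * measure (p t) {x}) \<in> U}"
    using U by (auto simp: continuous_map)
  also have "{t \<in> topspace T. (\<Sum>x\<in>X. f x * measure (p t) {x}) \<in> U} = p -` W \<inter> topspace T"
    using p fin by (auto simp: W integral_prob_measures)
  finally show "openin T (p -` W \<inter> topspace T)" .
qed

text \<open>The property of eventually containing \<open>p n\<close> holds for subbasic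
  neighbourhoods because integrals are finite sums. It survives finite intersections and arbitrary
  unions, which is the induction over the generated topology.\<close>

lemma limitin_weak_topology:
  fixes X :: "'a::t1_space set"
  assumes fin: "finite X" and p: "\<And>n. p n \<in> prob_measures X" "P \<in> prob_measures X"
    and c: "\<And>x. x \<in> X \<Longrightarrow> ((\<lambda>n. measure (p n) {x}) \<longlongrightarrow> measure P {x}) F"
  shows "limitin (weak_topology X) p P F"
  unfolding limitin_def topspace_weak_topology
proof (intro conjI allI impI)
  show "P \<in> prob_measures X" by fact
  fix W assume W: "openin (weak_topology X) W \<and> P \<in> W"
  then have "generate_topology_on {{P \<in> prob_measures X. (\<integral>y. f y \<partial>P) \<in> U} | (f :: 'a \<Rightarrow> real) U.
        continuous_on X f \<and> bounded (f ` X) \<and> open U} W"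
    unfolding weak_topology_def by (intro openin_topology_generated_by) auto
  then have "P \<in> W \<longrightarrow> (\<forall>\<^sub>F n in F. p n \<in> W)"
  proof induction
    case (UN K)
    show ?case
    proof
      assume "P \<in> \<Union>K"
      then obtain k where "k \<in> K" "P \<in> k" by blast
      with UN.IH[of k] show "\<forall>\<^sub>F n in F. p n \<in> \<Union>K" by (auto elim!: eventually_mono)
    qed
  next
    case (Basis W)
    then obtain f :: "'a \<Rightarrow> real" and U where
      W: "W = {P \<in> prob_measures X. (\<integral>y. f y \<partial>P) \<in> U}" and U: "open U" by blast
    have "((\<lambda>n. \<integral>y. f y \<partial>p n) \<longlongrightarrow> (\<integral>y. f y \<partial>P)) F"
      unfolding integral_prob_measures[OF fin p(1)] integral_prob_measures[OF fin p(2)]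
      by (intro tendsto_intros c)
    then show ?case
      using topological_tendstoD[of _ _ F U] U p by (simp add: W)
  qed (auto intro: eventually_conj)
  with W show "\<forall>\<^sub>F n in F. p n \<in> W" by blast
qed

text \<open>The distance to a fixed \<open>p \<theta>'\<close> is a finite sum of continuous
  functions of \<open>\<theta>\<close>, so the \<open>\<epsilon>\<close>-balls pulled back to
  \<open>\<Theta>\<close> are relatively open. They cover \<open>\<Theta>\<close> since each
  \<open>\<theta>\<close> has distance 0 from itself, and the centres of a finite subcover form the
  net.\<close>

lemma finite_l1_net:
  fixes X :: "'a::t1_space set" and \<Theta> :: "'b::topological_space set"
  assumes fin: "finite X" and cp: "compact \<Theta>" and "\<epsilon> > 0"
    and c: "\<And>x. x \<in> X \<Longrightarrow> continuous_on \<Theta> (\<lambda>\<theta>. measure (p \<theta>) {x})"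
  obtains F where "finite F" "F \<subseteq> \<Theta>" "\<And>\<theta>. \<theta> \<in> \<Theta> \<Longrightarrow> \<exists>\<theta>'\<in>F. l1_dist X (p \<theta>) (p \<theta>') < \<epsilon>"
proof -
  define U where "U \<theta>' = {\<theta> \<in> \<Theta>. l1_dist X (p \<theta>) (p \<theta>') < \<epsilon>}" for \<theta>'
  have "openin (top_of_set \<Theta>) (U \<theta>')" for \<theta>'
  proof -
    have "continuous_on \<Theta> (\<lambda>\<theta>. l1_dist X (p \<theta>) (p \<theta>'))"
      unfolding l1_dist_def by (intro continuous_intros c)
    then have "openin (top_of_set \<Theta>) (\<Theta> \<inter> (\<lambda>\<theta>. l1_dist X (p \<theta>) (p \<theta>')) -` {..<\<epsilon>})"
      by (rule continuous_openin_preimage_gen) simp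
    also have "\<Theta> \<inter> (\<lambda>\<theta>. l1_dist X (p \<theta>) (p \<theta>')) -` {..<\<epsilon>} = U \<theta>'" by (auto simp: U_def)
    finally show ?thesis .
  qed
  moreover have "\<Theta> \<subseteq> \<Union>(U ` \<Theta>)" using \<open>\<epsilon> > 0\<close> by (auto simp: U_def l1_dist_def)
  ultimately obtain D where "D \<subseteq> U ` \<Theta>" "finite D" "\<Theta> \<subseteq> \<Union>D"
    using cp[unfolded compact_eq_openin_cover, rule_format, of "U ` \<Theta>"] by auto
  then obtain F where "F \<subseteq> \<Theta>" "finite F" "\<Theta> \<subseteq> \<Union>(U ` F)"
    by (metis finite_subset_image)
  then show ?thesis by (intro that[of F]) (auto simp: U_def)
qed

section \<open>Two-step marginals of the path law\<close>

context Ionescu_Tulcea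
begin

text \<open>The limit's marginal on \<open>{0..<n}\<close> is \<open>CI\<close>, a projection of the
  iterated kernel at stage \<open>up_to {0..<n}\<close>. That stage is at least \<open>n\<close>, so
  projecting gives back stage \<open>n\<close>.\<close>

lemma C_eq_distr_lim:
  "C 0 n (\<lambda>_. undefined) = distr PF.lim (PiM {0..<n} M) (\<lambda>\<omega>. restrict \<omega> {0..<n})"
proof -
  have "n \<le> up_to {0..<n}"
    using up_to[of "{0..<n}"] by (cases n) auto
  then show ?thesis
    using distr_C[of n "up_to {0..<n}" "\<lambda>_. undefined" 0]
    by (simp add: distr_lim CI_def)
qed

lemma measurable_restrict_lim:
  "(\<lambda>\<omega>. restrict \<omega> J) \<in> measurable PF.lim (PiM J M)"
  by (auto simp: measurable_cong_sets[OF PF.sets_lim refl] intro: measurable_restrict_subset)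

lemma prob_space_lim: "prob_space PF.lim"
proof (rule prob_space_distrD[OF measurable_restrict_lim[of "{}"]])
  show "prob_space (distr PF.lim (PiM {} M) (\<lambda>\<omega>. restrict \<omega> {}))"
    by (subst distr_lim) (auto intro: PF.prob_space_P)
qed

text \<open>Stage \<open>Suc n\<close> of the iterated kernel is stage \<open>n\<close> bound with
  \<open>eP n\<close>. Reading both stages as marginals of the limit expresses the law of the first
  \<open>n + 1\<close> coordinates through the \<open>n\<close>-th kernel integrated over the path
  itself. The initial law and the Markov step below are both instances.\<close>

lemma emeasure_lim_Suc:
  assumes A: "A \<in> sets (PiM {0..<Suc n} M)"
  shows "emeasure PF.lim {\<omega> \<in> space (PiM UNIV M). restrict \<omega> {0..<Suc n} \<in> A} =
    (\<integral>\<^sup>+\<omega>. emeasure (P n (restrict \<omega> {0..<n}))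
       {x \<in> space (M n). (restrict \<omega> {0..<n})(n := x) \<in> A} \<partial>PF.lim)"
proof -
  let ?u = "\<lambda>_::nat. undefined :: 'a"
  have u: "?u \<in> space (PiM {0..<0} M)" by simp
  have "emeasure PF.lim {\<omega> \<in> space (PiM UNIV M). restrict \<omega> {0..<Suc n} \<in> A} = emeasure (C 0 (Suc n) ?u) A"
  proof -
    have "{\<omega> \<in> space (PiM UNIV M). restrict \<omega> {0..<Suc n} \<in> A} =
        (\<lambda>\<omega>. restrict \<omega> {0..<Suc n}) -` A \<inter> space PF.lim"
      unfolding PF.space_lim by blast
    then show ?thesis
      by (simp only: C_eq_distr_lim[of "Suc n"] emeasure_distr[OF measurable_restrict_lim A])
  qed
  also have "\<dots> = (\<integral>\<^sup>+\<omega>. emeasure (eP n \<omega>) A \<partial>C 0 n ?u)"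
  proof -
    have "space (C 0 n ?u) \<noteq> {}" by (rule prob_space.not_empty[OF prob_space_C[OF u]])
    moreover have "eP n \<in> measurable (C 0 n ?u) (subprob_algebra (PiM {0..<Suc n} M))"
      using measurable_eP unfolding measurable_cong_sets[OF sets_C[OF u, of n] refl] add_0 .
    ultimately show ?thesis
      unfolding C.simps add_0 by (rule emeasure_bind[OF _ _ A])
  qed
  also have "\<dots> = (\<integral>\<^sup>+\<omega>. emeasure (eP n (restrict \<omega> {0..<n})) A \<partial>PF.lim)"
    unfolding C_eq_distr_lim
    by (rule nn_integral_distr[OF measurable_restrict_lim], subst measurable_distr_eq1)
      (rule measurable_emeasure_kernel[OF measurable_eP A])
  also have "\<dots> = (\<integral>\<^sup>+\<omega>. emeasure (P n (restrict \<omega> {0..<n}))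
       {x \<in> space (M n). (restrict \<omega> {0..<n})(n := x) \<in> A} \<partial>PF.lim)"
  proof (rule nn_integral_cong)
    fix \<omega> assume "\<omega> \<in> space PF.lim"
    then have "restrict \<omega> {0..<n} \<in> space (PiM {0..<n} M)"
      by (auto simp: space_PiM)
    from emeasure_eP[OF this A]
    have "emeasure (eP n (restrict \<omega> {0..<n})) A = emeasure (P n (restrict \<omega> {0..<n}))
       (fun_upd (restrict \<omega> {0..<n}) n -` A \<inter> space (M n))" .
    also have "fun_upd (restrict \<omega> {0..<n}) n -` A \<inter> space (M n) =
        {x \<in> space (M n). (restrict \<omega> {0..<n})(n := x) \<in> A}"
      by blast
    finally show "emeasure (eP n (restrict \<omega> {0..<n})) A = emeasure (P n (restrict \<omega> {0..<n}))
       {x \<in> space (M n). (restrict \<omega> {0..<n})(n := x) \<in> A}" .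
  qed
  finally show ?thesis .
qed

end

lemma space_borel_on [simp]: "space (borel_on X) = X"
  by (simp add: space_restrict_space)

section \<open>Initial law, transitions and pair expectations of the chain\<close>

context
  fixes X :: "'x::t1_space set" and x :: 'x and \<kappa> :: "nat \<Rightarrow> 'x \<Rightarrow> 'x measure"
  assumes fin: "finite X" and x: "x \<in> X" and \<kappa>: "\<And>t y. y \<in> X \<Longrightarrow> \<kappa> t y \<in> prob_measures X"
begin

interpretation IT: Ionescu_Tulcea "step_kernel X x \<kappa>" "\<lambda>_. borel_on X"
  using fin x \<kappa> by (rule Ionescu_Tulcea_step_kernel)

lemma lim_eq_path_law: "IT.PF.lim = path_law X x \<kappa>"
  by (simp add: path_law_def)

lemma sets_path_law: "sets (path_law X x \<kappa>) = sets (PiM UNIV (\<lambda>_. borel_on X))"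
  by (simp add: path_law_def)

lemma space_path_law: "space (path_law X x \<kappa>) = (UNIV \<rightarrow> X)"
  by (simp add: path_law_def space_PiM PiE_def)

lemma prob_space_path_law: "prob_space (path_law X x \<kappa>)"
  unfolding path_law_def by (rule IT.prob_space_lim)

lemma sets_path_law_coordinate:
  "{\<omega> \<in> UNIV \<rightarrow> X. \<omega> t = z} \<in> sets (path_law X x \<kappa>)"
proof (cases "z \<in> X")
  case True
  then have "{z} \<in> sets (borel_on X)" using fin by (simp add: sets_borel_on_finite)
  from measurable_sets[OF measurable_component_singleton[of t UNIV "\<lambda>_. borel_on X"] this]
  have "(\<lambda>\<omega>. \<omega> t) -` {z} \<inter> space (PiM UNIV (\<lambda>_. borel_on X)) \<in> sets (path_law X x \<kappa>)"
    by (simp add: sets_path_law)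
  also have "(\<lambda>\<omega>. \<omega> t) -` {z} \<inter> space (PiM UNIV (\<lambda>_. borel_on X)) = {\<omega> \<in> UNIV \<rightarrow> X. \<omega> t = z}"
    by (auto simp: space_PiM PiE_def)
  finally show ?thesis .
next
  case False
  then have "{\<omega> \<in> UNIV \<rightarrow> X. \<omega> t = z} = {}" by auto
  then show ?thesis by (simp only: sets.empty_sets)
qed

lemma sets_path_law_pair:
  "{\<omega> \<in> UNIV \<rightarrow> X. \<omega> t = z \<and> \<omega> s = y} \<in> sets (path_law X x \<kappa>)"
proof -
  have "{\<omega> \<in> UNIV \<rightarrow> X. \<omega> t = z \<and> \<omega> s = y} = {\<omega> \<in> UNIV \<rightarrow> X. \<omega> t = z} \<inter> {\<omega> \<in> UNIV \<rightarrow> X. \<omega> s = y}"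
    by auto
  then show ?thesis using sets_path_law_coordinate by auto
qed

lemma path_law_initial:
  assumes y: "y \<in> X"
  shows "measure (path_law X x \<kappa>) {\<omega> \<in> UNIV \<rightarrow> X. \<omega> 0 = y} = (if y = x then 1 else 0)"
proof -
  interpret prob_space "path_law X x \<kappa>" by (rule prob_space_path_law)
  let ?A = "{\<omega> \<in> space (PiM {0..<Suc 0} (\<lambda>_. borel_on X)). \<omega> 0 \<in> {y}}"
  have ys: "{y} \<in> sets (borel_on X)" using fin y by (simp add: sets_borel_on_finite)
  have A: "?A \<in> sets (PiM {0..<Suc 0} (\<lambda>_. borel_on X))"
    using ys by (intro sets_Collect_single) auto
  have "emeasure (path_law X x \<kappa>) {\<omega> \<in> UNIV \<rightarrow> X. \<omega> 0 = y} =
      (\<integral>\<^sup>+\<omega>. emeasure (return (borel_on X) x) {y} \<partial>path_law X x \<kappa>)"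
  proof -
    have eq: "{\<omega> \<in> UNIV \<rightarrow> X. \<omega> 0 = y} =
        {\<omega> \<in> space (PiM UNIV (\<lambda>_. borel_on X)). restrict \<omega> {0..<Suc 0} \<in> ?A}"
      by (auto simp: space_PiM PiE_def)
    \<comment> \<open>No coordinate precedes 0, so the updated value alone decides membership in
      \<open>?A\<close>, whatever the path.\<close>
    moreover have "{x' \<in> X. (restrict \<omega> {0..<0})(0 := x') \<in> ?A} = {y}" if "\<omega> \<in> UNIV \<rightarrow> X" for \<omega> :: "nat \<Rightarrow> 'x"
      using that y by (auto simp: space_PiM PiE_def extensional_def)
    ultimately have "(\<integral>\<^sup>+\<omega>. emeasure (step_kernel X x \<kappa> 0 (restrict \<omega> {0..<0}))
          {x' \<in> X. (restrict \<omega> {0..<0})(0 := x') \<in> ?A} \<partial>path_law X x \<kappa>) =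
        (\<integral>\<^sup>+\<omega>. emeasure (return (borel_on X) x) {y} \<partial>path_law X x \<kappa>)"
      by (intro nn_integral_cong) (simp only: space_path_law step_kernel.simps)
    with IT.emeasure_lim_Suc[OF A] eq show ?thesis
      by (simp only: lim_eq_path_law space_borel_on)
  qed
  also have "\<dots> = (if y = x then 1 else 0)"
    using ys emeasure_space_1 by (auto simp: indicator_def)
  finally show ?thesis by (auto simp: measure_def)
qed

text \<open>The Markov property for a single pair of states: the kernel yielding coordinate
  \<open>Suc t\<close> sees the past only through \<open>\<omega> t\<close>, so it equals
  \<open>\<kappa> t z\<close> throughout the event \<open>\<omega> t = z\<close> and can be pulled
  out of the integral.\<close>

lemma path_law_step:
  assumes z: "z \<in> X" and y: "y \<in> X"
  shows "measure (path_law X x \<kappa>) {\<omega> \<in> UNIV \<rightarrow> X. \<omega> t = z \<and> \<omega> (Suc t) = y} =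
    measure (path_law X x \<kappa>) {\<omega> \<in> UNIV \<rightarrow> X. \<omega> t = z} * measure (\<kappa> t z) {y}"
proof -
  interpret prob_space "path_law X x \<kappa>" by (rule prob_space_path_law)
  interpret K: prob_space "\<kappa> t z" using \<kappa>[OF z] by (simp add: prob_measures_iff)
  \<comment> \<open>\<open>step_kernel\<close> reserves position 0 for the starting point, so
    \<open>\<kappa> t\<close> is the kernel at position \<open>Suc t\<close>.\<close>
  let ?n = "Suc t"
  let ?A = "{\<omega> \<in> space (PiM {0..<Suc ?n} (\<lambda>_. borel_on X)). \<omega> t \<in> {z} \<and> \<omega> ?n \<in> {y}}"
  let ?B = "{\<omega> \<in> UNIV \<rightarrow> X. \<omega> t = z}"
  have ys: "{y} \<in> sets (borel_on X)" "{z} \<in> sets (borel_on X)"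
    using fin y z by (simp_all add: sets_borel_on_finite)
  have A: "?A \<in> sets (PiM {0..<Suc ?n} (\<lambda>_. borel_on X))"
    using ys by (intro sets.sets_Collect_conj sets_Collect_single) auto
  have "emeasure (path_law X x \<kappa>) {\<omega> \<in> UNIV \<rightarrow> X. \<omega> t = z \<and> \<omega> ?n = y} =
      (\<integral>\<^sup>+\<omega>. emeasure (\<kappa> t z) {y} * indicator ?B \<omega> \<partial>path_law X x \<kappa>)"
  proof -
    have eq: "{\<omega> \<in> UNIV \<rightarrow> X. \<omega> t = z \<and> \<omega> ?n = y} =
        {\<omega> \<in> space (PiM UNIV (\<lambda>_. borel_on X)). restrict \<omega> {0..<Suc ?n} \<in> ?A}"
      by (auto simp: space_PiM PiE_def)
    moreover have "emeasure (step_kernel X x \<kappa> ?n (restrict \<omega> {0..<?n}))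
          {x' \<in> X. (restrict \<omega> {0..<?n})(?n := x') \<in> ?A} = emeasure (\<kappa> t z) {y} * indicator ?B \<omega>"
      if "\<omega> \<in> UNIV \<rightarrow> X" for \<omega> :: "nat \<Rightarrow> 'x"
    proof -
      \<comment> \<open>The update leaves coordinate \<open>t\<close> alone, so the condition
        \<open>\<omega> t = z\<close> does not involve \<open>x'\<close>; it becomes the indicator
        of \<open>?B\<close>.\<close>
      have "{x' \<in> X. (restrict \<omega> {0..<?n})(?n := x') \<in> ?A} = (if \<omega> t = z then {y} else {})"
        using that y by (auto simp: space_PiM PiE_def extensional_def Pi_iff)
      then show ?thesis using that by (auto simp: indicator_def)
    qed
    ultimately have "(\<integral>\<^sup>+\<omega>. emeasure (step_kernel X x \<kappa> ?n (restrict \<omega> {0..<?n}))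
          {x' \<in> X. (restrict \<omega> {0..<?n})(?n := x') \<in> ?A} \<partial>path_law X x \<kappa>) =
        (\<integral>\<^sup>+\<omega>. emeasure (\<kappa> t z) {y} * indicator ?B \<omega> \<partial>path_law X x \<kappa>)"
      by (intro nn_integral_cong) (simp only: space_path_law)
    with IT.emeasure_lim_Suc[OF A] eq show ?thesis
      by (simp only: lim_eq_path_law space_borel_on)
  qed
  also have "\<dots> = emeasure (\<kappa> t z) {y} * emeasure (path_law X x \<kappa>) ?B"
    using sets_path_law_coordinate by (rule nn_integral_cmult_indicator)
  finally show ?thesis
    by (simp add: measure_def enn2real_mult mult.commute)
qed

lemma path_law_Suc:
  assumes y: "y \<in> X"
  shows "measure (path_law X x \<kappa>) {\<omega> \<in> UNIV \<rightarrow> X. \<omega> (Suc t) = y} =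
    (\<Sum>z\<in>X. measure (path_law X x \<kappa>) {\<omega> \<in> UNIV \<rightarrow> X. \<omega> t = z} * measure (\<kappa> t z) {y})"
proof -
  interpret prob_space "path_law X x \<kappa>" by (rule prob_space_path_law)
  have "measure (path_law X x \<kappa>) (\<Union>z\<in>X. {\<omega> \<in> UNIV \<rightarrow> X. \<omega> t = z \<and> \<omega> (Suc t) = y}) =
      (\<Sum>z\<in>X. measure (path_law X x \<kappa>) {\<omega> \<in> UNIV \<rightarrow> X. \<omega> t = z \<and> \<omega> (Suc t) = y})"
    using fin sets_path_law_pair by (intro finite_measure_finite_Union) (auto simp: disjoint_family_on_def)
  also have "(\<Union>z\<in>X. {\<omega> \<in> UNIV \<rightarrow> X. \<omega> t = z \<and> \<omega> (Suc t) = y}) = {\<omega> \<in> UNIV \<rightarrow> X. \<omega> (Suc t) = y}"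
    by auto
  finally show ?thesis using y by (simp add: path_law_step)
qed

lemma sum_path_law_coordinate:
  "(\<Sum>z\<in>X. measure (path_law X x \<kappa>) {\<omega> \<in> UNIV \<rightarrow> X. \<omega> t = z}) = 1"
proof -
  interpret prob_space "path_law X x \<kappa>" by (rule prob_space_path_law)
  have "measure (path_law X x \<kappa>) (\<Union>z\<in>X. {\<omega> \<in> UNIV \<rightarrow> X. \<omega> t = z}) =
      (\<Sum>z\<in>X. measure (path_law X x \<kappa>) {\<omega> \<in> UNIV \<rightarrow> X. \<omega> t = z})"
    using fin sets_path_law_coordinate by (intro finite_measure_finite_Union) (auto simp: disjoint_family_on_def)
  also have "(\<Union>z\<in>X. {\<omega> \<in> UNIV \<rightarrow> X. \<omega> t = z}) = space (path_law X x \<kappa>)"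
    by (auto simp: space_path_law)
  finally show ?thesis by (simp add: prob_space)
qed

text \<open>The reward at time \<open>t\<close> depends on the path only through this pair: for a
  fixed policy, \<open>g\<close> absorbs the action \<open>a t (\<omega> t)\<close>.\<close>

lemma path_law_transition:
  fixes g :: "'x \<Rightarrow> 'x \<Rightarrow> real"
  shows "(\<integral>\<omega>. g (\<omega> t) (\<omega> (Suc t)) \<partial>path_law X x \<kappa>) =
      (\<Sum>z\<in>X. \<Sum>y\<in>X. g z y * (measure (path_law X x \<kappa>) {\<omega> \<in> UNIV \<rightarrow> X. \<omega> t = z} * measure (\<kappa> t z) {y}))"
    and "integrable (path_law X x \<kappa>) (\<lambda>\<omega>. g (\<omega> t) (\<omega> (Suc t)))"
proof -
  interpret prob_space "path_law X x \<kappa>" by (rule prob_space_path_law)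
  have s: "{\<omega> \<in> space (path_law X x \<kappa>). (\<omega> t, \<omega> (Suc t)) = s} = {\<omega> \<in> UNIV \<rightarrow> X. \<omega> t = fst s \<and> \<omega> (Suc t) = snd s}" for s
    by (cases s) (auto simp: space_path_law)
  have p: "\<And>s. {\<omega> \<in> space (path_law X x \<kappa>). (\<omega> t, \<omega> (Suc t)) = s} \<in> sets (path_law X x \<kappa>)"
    unfolding s by (rule sets_path_law_pair)
  have m: "\<And>\<omega>. \<omega> \<in> space (path_law X x \<kappa>) \<Longrightarrow> (\<omega> t, \<omega> (Suc t)) \<in> X \<times> X"
    by (auto simp: space_path_law)
  note F = integral_finite_range[of "X \<times> X" "\<lambda>\<omega>. (\<omega> t, \<omega> (Suc t))" "\<lambda>(z, y). g z y", OF _ m p]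
  show "(\<integral>\<omega>. g (\<omega> t) (\<omega> (Suc t)) \<partial>path_law X x \<kappa>) =
      (\<Sum>z\<in>X. \<Sum>y\<in>X. g z y * (measure (path_law X x \<kappa>) {\<omega> \<in> UNIV \<rightarrow> X. \<omega> t = z} * measure (\<kappa> t z) {y}))"
    using F(1) fin unfolding s sum.cartesian_product
    by (auto simp: path_law_step intro!: sum.cong)
  show "integrable (path_law X x \<kappa>) (\<lambda>\<omega>. g (\<omega> t) (\<omega> (Suc t)))"
    using F(2) fin by simp
qed

end

section \<open>Stability of the robust value\<close>

lemma path_law_transition_l1:
  fixes X :: "'x::t1_space set"
  assumes fin: "finite X" and x: "x \<in> X"
    and \<kappa>: "\<And>t y. y \<in> X \<Longrightarrow> \<kappa> t y \<in> prob_measures X"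
    and \<kappa>': "\<And>t y. y \<in> X \<Longrightarrow> \<kappa>' t y \<in> prob_measures X"
    and close: "\<And>t y. y \<in> X \<Longrightarrow> l1_dist X (\<kappa> t y) (\<kappa>' t y) \<le> \<eta>"
  defines "\<mu> \<equiv> \<lambda>t z. measure (path_law X x \<kappa>) {\<omega> \<in> UNIV \<rightarrow> X. \<omega> t = z}"
    and "\<mu>' \<equiv> \<lambda>t z. measure (path_law X x \<kappa>') {\<omega> \<in> UNIV \<rightarrow> X. \<omega> t = z}"
  shows "(\<Sum>z\<in>X. \<Sum>y\<in>X. \<bar>\<mu> t z * measure (\<kappa> t z) {y} - \<mu>' t z * measure (\<kappa>' t z) {y}\<bar>) \<le> real (Suc t) * \<eta>"
proof -
  define D where "D t = (\<Sum>z\<in>X. \<Sum>y\<in>X. \<bar>\<mu> t z * measure (\<kappa> t z) {y} - \<mu>' t z * measure (\<kappa>' t z) {y}\<bar>)" for t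
  define d where "d t = (\<Sum>z\<in>X. \<bar>\<mu> t z - \<mu>' t z\<bar>)" for t
  \<comment> \<open>Errors add up linearly: \<open>d (t + 1) \<le> D t \<le> d t + \<eta>\<close> and \<open>d 0 = 0\<close>.\<close>
  have D: "D t \<le> d t + \<eta>" for t
  proof -
    have "(\<Sum>y\<in>X. \<bar>\<mu> t z * measure (\<kappa> t z) {y} - \<mu>' t z * measure (\<kappa>' t z) {y}\<bar>)
        \<le> \<bar>\<mu> t z - \<mu>' t z\<bar> + \<mu>' t z * \<eta>" if z: "z \<in> X" for z
    proof -
      have nn: "0 \<le> \<mu>' t z" by (simp add: \<mu>'_def)
      have "(\<Sum>y\<in>X. \<bar>\<mu> t z * measure (\<kappa> t z) {y} - \<mu>' t z * measure (\<kappa>' t z) {y}\<bar>)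
          \<le> (\<Sum>y\<in>X. \<bar>\<mu> t z - \<mu>' t z\<bar> * measure (\<kappa> t z) {y} +
                 \<mu>' t z * \<bar>measure (\<kappa> t z) {y} - measure (\<kappa>' t z) {y}\<bar>)"
      proof (rule sum_mono)
        fix y
        \<comment> \<open>The marginal is exchanged first and the kernel second. Summed over
          \<open>y\<close>, the first error keeps weight one because \<open>\<kappa> t z\<close> is
          a probability measure; summed over \<open>z\<close>, the second is at most
          \<open>\<eta>\<close> because \<open>\<mu>' t\<close> has total mass one.\<close>
        have "\<mu> t z * measure (\<kappa> t z) {y} - \<mu>' t z * measure (\<kappa>' t z) {y} =
            (\<mu> t z - \<mu>' t z) * measure (\<kappa> t z) {y} + \<mu>' t z * (measure (\<kappa> t z) {y} - measure (\<kappa>' t z) {y})"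
          by (simp add: algebra_simps)
        then show "\<bar>\<mu> t z * measure (\<kappa> t z) {y} - \<mu>' t z * measure (\<kappa>' t z) {y}\<bar> \<le>
            \<bar>\<mu> t z - \<mu>' t z\<bar> * measure (\<kappa> t z) {y} + \<mu>' t z * \<bar>measure (\<kappa> t z) {y} - measure (\<kappa>' t z) {y}\<bar>"
          using nn abs_triangle_ineq by (metis abs_mult abs_of_nonneg measure_nonneg)
      qed
      also have "\<dots> = \<bar>\<mu> t z - \<mu>' t z\<bar> + \<mu>' t z * l1_dist X (\<kappa> t z) (\<kappa>' t z)"
        using sum_measure_prob_measures[OF fin \<kappa>[OF z]]
        by (simp add: sum.distrib sum_distrib_left[symmetric] l1_dist_def)
      finally show ?thesis
        using mult_left_mono[OF close[OF z] nn, of t] by linarith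
    qed
    then have "D t \<le> (\<Sum>z\<in>X. \<bar>\<mu> t z - \<mu>' t z\<bar> + \<mu>' t z * \<eta>)"
      unfolding D_def by (rule sum_mono)
    also have "\<dots> = d t + \<eta>"
      using sum_path_law_coordinate[where \<kappa>=\<kappa>' and t=t, OF fin x \<kappa>']
      by (simp add: sum.distrib sum_distrib_right[symmetric] d_def \<mu>'_def)
    finally show ?thesis .
  qed
  have d: "d t \<le> real t * \<eta>" for t
  proof (induction t)
    case 0
    \<comment> \<open>Both chains start at the same point \<open>x\<close>.\<close>
    have "\<mu> 0 y = \<mu>' 0 y" if "y \<in> X" for y
      using path_law_initial[where \<kappa>=\<kappa>, OF fin x \<kappa> that] path_law_initial[where \<kappa>=\<kappa>', OF fin x \<kappa>' that]
      by (simp add: \<mu>_def \<mu>'_def)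
    then show ?case by (simp add: d_def)
  next
    case (Suc t)
    \<comment> \<open>The next marginal is the joint law summed over the previous state, and summing
      out a coordinate cannot increase the distance.\<close>
    have "d (Suc t) = (\<Sum>y\<in>X. \<bar>\<Sum>z\<in>X. \<mu> t z * measure (\<kappa> t z) {y} - \<mu>' t z * measure (\<kappa>' t z) {y}\<bar>)"
      unfolding d_def sum_subtractf
      by (intro sum.cong refl)
        (simp add: \<mu>_def \<mu>'_def path_law_Suc[where \<kappa>=\<kappa>, OF fin x \<kappa>] path_law_Suc[where \<kappa>=\<kappa>', OF fin x \<kappa>'])
    also have "\<dots> \<le> (\<Sum>y\<in>X. \<Sum>z\<in>X. \<bar>\<mu> t z * measure (\<kappa> t z) {y} - \<mu>' t z * measure (\<kappa>' t z) {y}\<bar>)"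
      by (intro sum_mono sum_abs)
    also have "\<dots> = D t" unfolding D_def by (rule sum.swap)
    finally show ?case using D[of t] Suc by (simp add: algebra_simps)
  qed
  show ?thesis
    using D[of t] d[of t] unfolding D_def by (simp add: algebra_simps)
qed

lemma abs_path_law_transition_diff_le:
  fixes X :: "'x::t1_space set" and g :: "'x \<Rightarrow> 'x \<Rightarrow> real"
  assumes fin: "finite X" and x: "x \<in> X"
    and \<kappa>: "\<And>t y. y \<in> X \<Longrightarrow> \<kappa> t y \<in> prob_measures X"
    and \<kappa>': "\<And>t y. y \<in> X \<Longrightarrow> \<kappa>' t y \<in> prob_measures X"
    and close: "\<And>t y. y \<in> X \<Longrightarrow> l1_dist X (\<kappa> t y) (\<kappa>' t y) \<le> \<eta>"
    and g: "\<And>z y. z \<in> X \<Longrightarrow> y \<in> X \<Longrightarrow> \<bar>g z y\<bar> \<le> M"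
  shows "\<bar>(\<integral>\<omega>. g (\<omega> t) (\<omega> (Suc t)) \<partial>path_law X x \<kappa>) - (\<integral>\<omega>. g (\<omega> t) (\<omega> (Suc t)) \<partial>path_law X x \<kappa>')\<bar>
    \<le> M * (real (Suc t) * \<eta>)"
proof -
  have M: "M \<ge> 0" using g[OF x x] by linarith
  define p where "p z y = measure (path_law X x \<kappa>) {\<omega> \<in> UNIV \<rightarrow> X. \<omega> t = z} * measure (\<kappa> t z) {y}" for z y
  define p' where "p' z y = measure (path_law X x \<kappa>') {\<omega> \<in> UNIV \<rightarrow> X. \<omega> t = z} * measure (\<kappa>' t z) {y}" for z y
  have "(\<integral>\<omega>. g (\<omega> t) (\<omega> (Suc t)) \<partial>path_law X x \<kappa>) - (\<integral>\<omega>. g (\<omega> t) (\<omega> (Suc t)) \<partial>path_law X x \<kappa>')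
      = (\<Sum>z\<in>X. \<Sum>y\<in>X. g z y * (p z y - p' z y))"
    by (simp add: path_law_transition(1)[where \<kappa>=\<kappa>, OF fin x \<kappa>] path_law_transition(1)[where \<kappa>=\<kappa>', OF fin x \<kappa>']
        p_def p'_def right_diff_distrib sum_subtractf)
  also have "\<bar>\<dots>\<bar> \<le> (\<Sum>z\<in>X. \<Sum>y\<in>X. \<bar>g z y * (p z y - p' z y)\<bar>)"
    by (intro order_trans[OF sum_abs] sum_mono sum_abs)
  also have "\<dots> \<le> (\<Sum>z\<in>X. \<Sum>y\<in>X. M * \<bar>p z y - p' z y\<bar>)"
    using g by (intro sum_mono) (auto simp: abs_mult intro!: mult_right_mono)
  also have "\<dots> = M * (\<Sum>z\<in>X. \<Sum>y\<in>X. \<bar>p z y - p' z y\<bar>)"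
    by (simp add: sum_distrib_left)
  also have "\<dots> \<le> M * (real (Suc t) * \<eta>)"
    unfolding p_def p'_def
    using path_law_transition_l1[where \<kappa>=\<kappa> and \<kappa>'=\<kappa>', OF fin x \<kappa> \<kappa>' close] M by (intro mult_left_mono)
  finally show ?thesis .
qed

section \<open>Discounted returns as functions of the kernels\<close>

definition expected_return ::
  "'x::topological_space set \<Rightarrow> ('x \<Rightarrow> 'a \<Rightarrow> 'x \<Rightarrow> real) \<Rightarrow> real \<Rightarrow> 'x \<Rightarrow> (nat \<Rightarrow> 'x \<Rightarrow> 'a) \<Rightarrow>
   (nat \<Rightarrow> 'x \<Rightarrow> 'x measure) \<Rightarrow> real" where
  "expected_return X r \<alpha> x a \<kappa> =
     (\<integral>\<omega>. (\<Sum>t. \<alpha> ^ t * r (\<omega> t) (a t (\<omega> t)) (\<omega> (Suc t))) \<partial>path_law X x \<kappa>)"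

context
  fixes X :: "'x::t1_space set" and x :: 'x and r :: "'x \<Rightarrow> 'a \<Rightarrow> 'x \<Rightarrow> real"
    and \<alpha> :: real and a :: "nat \<Rightarrow> 'x \<Rightarrow> 'a" and M :: real
  assumes fin: "finite X" and x: "x \<in> X" and \<alpha>: "0 < \<alpha>" "\<alpha> < 1"
    and r: "\<And>t z y. z \<in> X \<Longrightarrow> y \<in> X \<Longrightarrow> \<bar>r z (a t z) y\<bar> \<le> M"
begin

text \<open>Exchanging sum and expectation reduces the comparison of returns to one time at a time.
  The uniform bound ensures later that the real infima and suprema are over bounded sets.\<close>

lemma expected_return_sums:
  assumes \<kappa>: "\<And>t y. y \<in> X \<Longrightarrow> \<kappa> t y \<in> prob_measures X"
  shows "(\<lambda>t. \<alpha> ^ t * (\<integral>\<omega>. r (\<omega> t) (a t (\<omega> t)) (\<omega> (Suc t)) \<partial>path_law X x \<kappa>))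
      sums expected_return X r \<alpha> x a \<kappa>"
    and "\<bar>expected_return X r \<alpha> x a \<kappa>\<bar> \<le> M / (1 - \<alpha>)"
proof -
  let ?Q = "path_law X x \<kappa>"
  interpret prob_space ?Q using fin x \<kappa> by (rule prob_space_path_law)
  let ?h = "\<lambda>t \<omega>. r (\<omega> t) (a t (\<omega> t)) (\<omega> (Suc t))"
  have int: "integrable ?Q (?h t)" for t
    using path_law_transition(2)[where \<kappa>=\<kappa> and g="\<lambda>z y. r z (a t z) y", OF fin x \<kappa>] by simp
  have sp: "\<bar>?h t \<omega>\<bar> \<le> M" if "\<omega> \<in> space ?Q" for t \<omega>
    using that space_path_law[where \<kappa>=\<kappa>, OF fin x \<kappa>] by (intro r) auto
  have geo: "summable (\<lambda>t. \<alpha> ^ t * M)"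
    using \<alpha> by (intro summable_mult2 summable_geometric) auto
  have Eabs: "(\<integral>\<omega>. \<bar>?h t \<omega>\<bar> \<partial>?Q) \<le> M" for t
    using sp int by (intro integral_le_const) auto
  have norm: "norm (\<alpha> ^ t * c) = \<alpha> ^ t * \<bar>c\<bar>" for t c
    using \<alpha> by (simp add: abs_mult)
  have le: "\<alpha> ^ t * c \<le> \<alpha> ^ t * M" if "c \<le> M" for t c
    using \<alpha> that by (intro mult_left_mono) auto
  \<comment> \<open>Facts \<open>1\<close>, \<open>2\<close>, \<open>3\<close> are the premises of
    \<open>sums_integral\<close>: integrable terms, almost sure absolute summability, and summable
    expected absolute values. The geometric series \<open>\<alpha> ^ t * M\<close> dominates in the
    last two.\<close>
  have 1: "integrable ?Q (\<lambda>\<omega>. \<alpha> ^ t * ?h t \<omega>)" for t using int by simp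
  have 2: "AE \<omega> in ?Q. summable (\<lambda>t. norm (\<alpha> ^ t * ?h t \<omega>))"
  proof (rule AE_I2)
    fix \<omega> assume "\<omega> \<in> space ?Q"
    then have "norm (norm (\<alpha> ^ t * ?h t \<omega>)) \<le> \<alpha> ^ t * M" for t
      unfolding norm abs_idempotent by (intro le sp)
    then show "summable (\<lambda>t. norm (\<alpha> ^ t * ?h t \<omega>))"
      by (rule summable_comparison_test'[OF geo, of 0])
  qed
  have 3: "summable (\<lambda>t. \<integral>\<omega>. norm (\<alpha> ^ t * ?h t \<omega>) \<partial>?Q)"
  proof (rule summable_comparison_test'[OF geo, of 0])
    fix t
    have "(\<integral>\<omega>. norm (\<alpha> ^ t * ?h t \<omega>) \<partial>?Q) = \<alpha> ^ t * (\<integral>\<omega>. \<bar>?h t \<omega>\<bar> \<partial>?Q)"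
      unfolding norm by simp
    moreover have "0 \<le> (\<integral>\<omega>. \<bar>?h t \<omega>\<bar> \<partial>?Q)" by simp
    ultimately show "norm (\<integral>\<omega>. norm (\<alpha> ^ t * ?h t \<omega>) \<partial>?Q) \<le> \<alpha> ^ t * M"
      using le[OF Eabs] \<alpha> by (simp add: abs_mult)
  qed
  show sums: "(\<lambda>t. \<alpha> ^ t * (\<integral>\<omega>. ?h t \<omega> \<partial>?Q)) sums expected_return X r \<alpha> x a \<kappa>"
    using sums_integral[OF 1 2 3] unfolding expected_return_def by simp
  have b: "norm (\<alpha> ^ t * (\<integral>\<omega>. ?h t \<omega> \<partial>?Q)) \<le> \<alpha> ^ t * M" for t
    unfolding norm by (intro le order_trans[OF integral_abs_bound Eabs])
  have "norm (\<Sum>t. \<alpha> ^ t * (\<integral>\<omega>. ?h t \<omega> \<partial>?Q)) \<le> (\<Sum>t. \<alpha> ^ t * M)"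
    by (rule norm_suminf_le[OF b geo])
  also have "(\<Sum>t. \<alpha> ^ t * M) = M / (1 - \<alpha>)"
    using \<alpha> by (subst suminf_mult2[symmetric]) (auto simp: suminf_geometric summable_geometric)
  finally show "\<bar>expected_return X r \<alpha> x a \<kappa>\<bar> \<le> M / (1 - \<alpha>)"
    using sums_unique[OF sums] by simp
qed

lemma expected_return_diff_le:
  assumes \<kappa>: "\<And>t y. y \<in> X \<Longrightarrow> \<kappa> t y \<in> prob_measures X"
    and \<kappa>': "\<And>t y. y \<in> X \<Longrightarrow> \<kappa>' t y \<in> prob_measures X"
    and close: "\<And>t y. y \<in> X \<Longrightarrow> l1_dist X (\<kappa> t y) (\<kappa>' t y) \<le> \<eta>"
  shows "\<bar>expected_return X r \<alpha> x a \<kappa> - expected_return X r \<alpha> x a \<kappa>'\<bar> \<le> M * \<eta> / (1 - \<alpha>)\<^sup>2"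
proof -
  let ?E = "\<lambda>\<kappa> t. \<integral>\<omega>. r (\<omega> t) (a t (\<omega> t)) (\<omega> (Suc t)) \<partial>path_law X x \<kappa>"
  have s: "(\<lambda>t. \<alpha> ^ t * (?E \<kappa> t - ?E \<kappa>' t)) sums (expected_return X r \<alpha> x a \<kappa> - expected_return X r \<alpha> x a \<kappa>')"
    using sums_diff[OF expected_return_sums(1)[where \<kappa>=\<kappa>, OF \<kappa>] expected_return_sums(1)[where \<kappa>=\<kappa>', OF \<kappa>']]
    by (simp add: right_diff_distrib)
  \<comment> \<open>The linear growth of the error in \<open>t\<close> turns the geometric series
    into its derivative, whence the squared denominator.\<close>
  have g: "(\<lambda>t. M * \<eta> * (real (Suc t) * \<alpha> ^ t)) sums (M * \<eta> * (1 / (1 - \<alpha>)\<^sup>2))"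
    using \<alpha> geometric_deriv_sums[of \<alpha>] by (intro sums_mult) auto
  have b: "norm (\<alpha> ^ t * (?E \<kappa> t - ?E \<kappa>' t)) \<le> M * \<eta> * (real (Suc t) * \<alpha> ^ t)" for t
  proof -
    have "\<bar>?E \<kappa> t - ?E \<kappa>' t\<bar> \<le> M * (real (Suc t) * \<eta>)"
      using abs_path_law_transition_diff_le[where \<kappa>=\<kappa> and \<kappa>'=\<kappa>' and g="\<lambda>z y. r z (a t z) y", OF fin x \<kappa> \<kappa>' close] r
      by simp
    from mult_left_mono[OF this, of "\<alpha> ^ t"] show ?thesis
      using \<alpha> by (simp add: abs_mult mult_ac)
  qed
  have "norm (\<Sum>t. \<alpha> ^ t * (?E \<kappa> t - ?E \<kappa>' t)) \<le> (\<Sum>t. M * \<eta> * (real (Suc t) * \<alpha> ^ t))"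
    by (rule norm_suminf_le[OF b sums_summable[OF g]])
  then show ?thesis
    using sums_unique[OF s] sums_unique[OF g] by simp
qed

end

text \<open>Indexing the infimum by kernel sequences instead of path laws makes it possible to
  compare two ambiguity sets kernel by kernel.\<close>

lemma robust_value_alt:
  "robust_value X A r \<alpha> R x = (SUP a \<in> {a. \<forall>t::nat. a t \<in> X \<rightarrow> A}.
     INF \<kappa> \<in> {\<kappa>. \<forall>t. \<forall>y\<in>X. \<kappa> t y \<in> R y (a t y)}. expected_return X r \<alpha> x a \<kappa>)"
proof -
  have "path_laws X R x a = path_law X x ` {\<kappa>. \<forall>t. \<forall>y\<in>X. \<kappa> t y \<in> R y (a t y)}" for a :: "nat \<Rightarrow> _"
    by (auto simp: path_laws_def)
  then show ?thesis
    by (simp add: robust_value_def image_image expected_return_def)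
qed

text \<open>Both comparisons are made for a fixed policy and then passed to the supremum. Shrinking
  the ambiguity set can only raise the infimum; conversely, every kernel sequence from
  \<open>R\<close> has a nearby one from \<open>R'\<close>, with an error independent of the
  policy.\<close>

lemma robust_value_approx:
  fixes X :: "'x::t1_space set" and A :: "'a set"
  assumes fin: "finite X" and A: "A \<noteq> {}" and \<alpha>: "0 < \<alpha>" "\<alpha> < 1"
    and r: "\<And>x a y. x \<in> X \<Longrightarrow> a \<in> A \<Longrightarrow> y \<in> X \<Longrightarrow> \<bar>r x a y\<bar> \<le> M"
    and R: "\<And>x a. x \<in> X \<Longrightarrow> a \<in> A \<Longrightarrow> R x a \<subseteq> prob_measures X"
    and R': "\<And>x a. x \<in> X \<Longrightarrow> a \<in> A \<Longrightarrow> R' x a \<noteq> {} \<and> R' x a \<subseteq> R x a"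
    and net: "\<And>x a P. x \<in> X \<Longrightarrow> a \<in> A \<Longrightarrow> P \<in> R x a \<Longrightarrow> \<exists>P'\<in>R' x a. l1_dist X P P' \<le> \<eta>"
    and x: "x \<in> X"
  shows "robust_value X A r \<alpha> R x \<le> robust_value X A r \<alpha> R' x"
    and "robust_value X A r \<alpha> R' x \<le> robust_value X A r \<alpha> R x + M * \<eta> / (1 - \<alpha>)\<^sup>2"
    and "\<bar>robust_value X A r \<alpha> R x\<bar> \<le> M / (1 - \<alpha>)"
proof -
  define pol where "pol = {a. \<forall>t::nat. a t \<in> X \<rightarrow> A}"
  define K where "K S a = {\<kappa>. \<forall>t::nat. \<forall>y\<in>X. \<kappa> t y \<in> S y (a t y)}" for S :: "'x \<Rightarrow> 'a \<Rightarrow> 'x measure set" and a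
  define I where "I S a = (INF \<kappa>\<in>K S a. expected_return X r \<alpha> x a \<kappa>)" for S a
  have V: "robust_value X A r \<alpha> S x = (SUP a\<in>pol. I S a)" for S
    by (simp add: robust_value_alt pol_def K_def I_def)
  have pol: "pol \<noteq> {}" using A by (auto simp: pol_def intro: exI[of _ "\<lambda>_ _. SOME a. a \<in> A"] some_in_eq[THEN iffD2])
  have polA: "a t y \<in> A" if "a \<in> pol" "y \<in> X" for a t y using that by (auto simp: pol_def)
  have sub: "K R' a \<subseteq> K R a" if "a \<in> pol" for a using R' polA[OF that] by (fastforce simp: K_def)
  have ne': "K R' a \<noteq> {}" if "a \<in> pol" for a
  proof -
    have "(\<lambda>t y. SOME P. P \<in> R' y (a t y)) \<in> K R' a"
      using R' polA[OF that] by (auto simp: K_def some_in_eq)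
    then show ?thesis by auto
  qed
  have ne: "K R a \<noteq> {}" if "a \<in> pol" for a using sub[OF that] ne'[OF that] by auto
  have prob: "\<kappa> t y \<in> prob_measures X" if "a \<in> pol" "\<kappa> \<in> K R a" "y \<in> X" for a \<kappa> t y
  proof -
    have "\<kappa> t y \<in> R y (a t y)" using that by (simp add: K_def)
    then show ?thesis using R[OF that(3) polA[OF that(1,3)]] by blast
  qed
  have ra: "\<bar>r z (a t z) y\<bar> \<le> M" if "a \<in> pol" "z \<in> X" "y \<in> X" for a t z y
    using r polA that by auto
  \<comment> \<open>The boundedness conditions for all the real infima and suprema below start from
    this bound.\<close>
  have bd: "\<bar>expected_return X r \<alpha> x a \<kappa>\<bar> \<le> M / (1 - \<alpha>)" if "a \<in> pol" "\<kappa> \<in> K R a" for a \<kappa>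
    using fin x \<alpha> ra[OF that(1)] prob[OF that] by (rule expected_return_sums(2))
  have bdd: "bdd_below (expected_return X r \<alpha> x a ` K R a)" if "a \<in> pol" for a
    using bd[OF that] by (intro bdd_belowI2[of _ "- (M / (1 - \<alpha>))"]) (simp add: abs_le_iff minus_le_iff)
  have bdd': "bdd_below (expected_return X r \<alpha> x a ` K R' a)" if "a \<in> pol" for a
    using bdd[OF that] sub[OF that] by (meson bdd_below_mono image_mono)
  have I1: "I R a \<le> I R' a" if "a \<in> pol" for a
    unfolding I_def by (intro cINF_superset_mono ne' bdd sub that order_refl)
  have I2: "I R' a \<le> I R a + M * \<eta> / (1 - \<alpha>)\<^sup>2" if a: "a \<in> pol" for a
  proof -
    have "I R' a - M * \<eta> / (1 - \<alpha>)\<^sup>2 \<le> I R a"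
      unfolding I_def[of R]
    proof (rule cINF_greatest[OF ne[OF a]])
      fix \<kappa> assume \<kappa>: "\<kappa> \<in> K R a"
      \<comment> \<open>Admissibility is a separate condition for each time and state, so the
        replacement may be chosen independently at every pair \<open>t\<close>,
        \<open>y\<close>.\<close>
      define \<kappa>' where "\<kappa>' t y = (SOME P'. P' \<in> R' y (a t y) \<and> l1_dist X (\<kappa> t y) P' \<le> \<eta>)" for t y
      have \<kappa>': "\<kappa>' t y \<in> R' y (a t y)" "l1_dist X (\<kappa> t y) (\<kappa>' t y) \<le> \<eta>" if y: "y \<in> X" for t y
      proof -
        have "\<kappa> t y \<in> R y (a t y)" using \<kappa> y by (simp add: K_def)
        from net[OF y polA[OF a y] this]
        have "\<exists>P'. P' \<in> R' y (a t y) \<and> l1_dist X (\<kappa> t y) P' \<le> \<eta>" by blast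
        from someI_ex[OF this]
        show "\<kappa>' t y \<in> R' y (a t y)" "l1_dist X (\<kappa> t y) (\<kappa>' t y) \<le> \<eta>"
          unfolding \<kappa>'_def by blast+
      qed
      then have "\<kappa>' \<in> K R' a" by (auto simp: K_def)
      then have "I R' a \<le> expected_return X r \<alpha> x a \<kappa>'" and K: "\<kappa>' \<in> K R a"
        using sub[OF a] unfolding I_def by (auto intro: cINF_lower[OF bdd'[OF a]])
      moreover have "\<bar>expected_return X r \<alpha> x a \<kappa> - expected_return X r \<alpha> x a \<kappa>'\<bar> \<le> M * \<eta> / (1 - \<alpha>)\<^sup>2"
        using fin x \<alpha> ra[OF a] prob[OF a \<kappa>] prob[OF a K] \<kappa>'(2) by (rule expected_return_diff_le)
      ultimately show "I R' a - M * \<eta> / (1 - \<alpha>)\<^sup>2 \<le> expected_return X r \<alpha> x a \<kappa>"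
        by linarith
    qed
    then show ?thesis by linarith
  qed
  have Ib: "\<bar>I R a\<bar> \<le> M / (1 - \<alpha>)" if a: "a \<in> pol" for a
    unfolding I_def using bd[OF a] by (intro cInf_abs_ge) (use ne[OF a] in auto)
  have upR: "bdd_above (I R ` pol)"
    using Ib by (intro bdd_aboveI2[of _ _ "M / (1 - \<alpha>)"]) (simp add: abs_le_iff)
  have upR': "bdd_above (I R' ` pol)"
    using Ib I2 by (intro bdd_aboveI2[of _ _ "M / (1 - \<alpha>) + M * \<eta> / (1 - \<alpha>)\<^sup>2"]) (fastforce simp: abs_le_iff)
  show "robust_value X A r \<alpha> R x \<le> robust_value X A r \<alpha> R' x"
    unfolding V by (rule cSUP_mono[OF pol upR']) (use I1 in blast)
  show "robust_value X A r \<alpha> R' x \<le> robust_value X A r \<alpha> R x + M * \<eta> / (1 - \<alpha>)\<^sup>2"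
    unfolding V
  proof (rule cSUP_least[OF pol])
    fix a assume a: "a \<in> pol"
    show "I R' a \<le> (SUP a\<in>pol. I R a) + M * \<eta> / (1 - \<alpha>)\<^sup>2"
      using I2[OF a] cSUP_upper[OF a upR] by linarith
  qed
  show "\<bar>robust_value X A r \<alpha> R x\<bar> \<le> M / (1 - \<alpha>)"
    unfolding V using pol Ib by (intro cSup_abs_le) auto
qed

section \<open>Approximation by finite parameter sets\<close>

lemma tendsto_l1_dist_zero_imp_point_mass:
  assumes "finite X" "x \<in> X" "((\<lambda>n. l1_dist X P (p n)) \<longlongrightarrow> 0) F"
  shows "((\<lambda>n. measure (p n) {x}) \<longlongrightarrow> measure P {x}) F"
proof (rule Lim_transform_bound[OF _ assms(3), THEN Lim_null[THEN iffD2]])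
  show "\<forall>\<^sub>F n in F. norm (measure (p n) {x} - measure P {x}) \<le> norm (l1_dist X P (p n))"
  proof (rule always_eventually, rule allI)
    fix n
    have "\<bar>measure P {x} - measure (p n) {x}\<bar> \<le> l1_dist X P (p n)"
      unfolding l1_dist_def using assms(1,2) by (intro member_le_sum) auto
    then show "norm (measure (p n) {x} - measure P {x}) \<le> norm (l1_dist X P (p n))"
      by (simp add: abs_minus_commute)
  qed
qed

theorem lemma4p5:
  fixes X :: "(real ^ 'd) set" and A :: "(real ^ 'm) set"
    and r :: "real ^ 'd \<Rightarrow> real ^ 'm \<Rightarrow> real ^ 'd \<Rightarrow> real"
    and \<alpha> :: real
    and \<Theta> :: "real ^ 'd \<Rightarrow> real ^ 'm \<Rightarrow> (real ^ 'k) set"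
    and Phat :: "real ^ 'd \<Rightarrow> real ^ 'm \<Rightarrow> real ^ 'k \<Rightarrow> (real ^ 'd) measure"
  assumes "finite X" "X \<noteq> {}" "finite A" "A \<noteq> {}"
    and "0 < \<alpha>" "\<alpha> < 1"
    and "\<And>x a. x \<in> X \<Longrightarrow> a \<in> A \<Longrightarrow> \<Theta> x a \<noteq> {}"
    and "\<And>x a. x \<in> X \<Longrightarrow> a \<in> A \<Longrightarrow> compact (\<Theta> x a)"
    and "\<And>x a \<theta>. x \<in> X \<Longrightarrow> a \<in> A \<Longrightarrow> \<theta> \<in> \<Theta> x a \<Longrightarrow> Phat x a \<theta> \<in> prob_measures X"
    and "\<And>x a. x \<in> X \<Longrightarrow> a \<in> A \<Longrightarrow>
           continuous_map (top_of_set (\<Theta> x a)) (wasserstein1_topology X) (Phat x a)"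
  shows "\<exists>\<Theta>n :: nat \<Rightarrow> real ^ 'd \<Rightarrow> real ^ 'm \<Rightarrow> (real ^ 'k) set.
    (\<forall>n. \<forall>x\<in>X. \<forall>a\<in>A. finite (\<Theta>n n x a) \<and> \<Theta>n n x a \<subseteq> \<Theta> x a) \<and>
    (let R = param_ambiguity Phat \<Theta>;
         Rn = (\<lambda>n. param_ambiguity Phat (\<Theta>n n));
         V = robust_value X A r \<alpha> R;
         Vn = (\<lambda>n. robust_value X A r \<alpha> (Rn n))
     in
       (\<forall>x\<in>X. \<forall>a\<in>A. R x a \<noteq> {} \<and> compactin (weak_topology X) (R x a)) \<and>
       upper_hemicontinuous_map (top_of_set (X \<times> A)) (weak_topology X) (\<lambda>(x, a). R x a) \<and>
       lower_hemicontinuous_map (top_of_set (X \<times> A)) (weak_topology X) (\<lambda>(x, a). R x a) \<and>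
       (\<forall>x\<in>X. \<forall>a\<in>A. \<forall>P\<in>R x a. \<exists>Pn :: nat \<Rightarrow> (real ^ 'd) measure.
          (\<forall>n. Pn n \<in> Rn n x a \<and> Rn n x a \<subseteq> R x a) \<and>
          limitin (weak_topology X) Pn P sequentially \<and>
          (\<lambda>n. \<integral>y. norm y \<partial>Pn n) \<longlonglongrightarrow> (\<integral>y. norm y \<partial>P)) \<and>
       (\<forall>x\<in>X. \<forall>a\<in>A.
          (\<lambda>n. INF P \<in> Rn n x a. \<integral>y. r x a y + \<alpha> * Vn n y \<partial>P)
            \<longlonglongrightarrow> (INF P \<in> R x a. \<integral>y. r x a y + \<alpha> * V y \<partial>P)))"
proof -
  note fin = \<open>finite X\<close> and prob = assms(9)
  \<comment> \<open>The Wasserstein continuity hypothesis enters here; from now on only point masses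
    are considered.\<close>
  have mass: "continuous_on (\<Theta> x a) (\<lambda>\<theta>. measure (Phat x a \<theta>) {y})"
    if "x \<in> X" "a \<in> A" "y \<in> X" for x a y
    using continuous_map_compose[OF assms(10)[OF that(1,2)] continuous_map_point_mass[OF fin that(3)]]
    by (simp add: o_def)
  \<comment> \<open>The radius uses \<open>Suc n\<close> so that it is positive for
    \<open>n = 0\<close> as well.\<close>
  define net where "net n x a F \<longleftrightarrow> finite F \<and> F \<subseteq> \<Theta> x a \<and>
      (\<forall>\<theta>\<in>\<Theta> x a. \<exists>\<theta>'\<in>F. l1_dist X (Phat x a \<theta>) (Phat x a \<theta>') < 1 / real (Suc n))" for n x a F
  define \<Theta>n where "\<Theta>n n x a = (SOME F. net n x a F)" for n x a
  have net: "net n x a (\<Theta>n n x a)" if "x \<in> X" "a \<in> A" for n x a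
    unfolding \<Theta>n_def
  proof (rule someI_ex)
    show "\<exists>F. net n x a F"
      using finite_l1_net[OF fin assms(8)[OF that] _ mass[OF that], of "1 / real (Suc n)"]
      unfolding net_def by (metis of_nat_0_less_iff zero_less_Suc zero_less_divide_1_iff)
  qed
  define R where "R = param_ambiguity Phat \<Theta>"
  define Rn where "Rn n = param_ambiguity Phat (\<Theta>n n)" for n
  define V where "V = robust_value X A r \<alpha> R"
  define Vn where "Vn n = robust_value X A r \<alpha> (Rn n)" for n
  have R_image: "R x a = Phat x a ` \<Theta> x a" for x a
    by (auto simp: R_def param_ambiguity_def)
  have Rn_image: "Rn n x a = Phat x a ` \<Theta>n n x a" for n x a
    by (auto simp: Rn_def param_ambiguity_def)
  have R_ne: "R x a \<noteq> {}" if "x \<in> X" "a \<in> A" for x a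
    using assms(7)[OF that] by (simp add: R_image)
  have R_prob: "R x a \<subseteq> prob_measures X" if "x \<in> X" "a \<in> A" for x a
    using prob[OF that] by (auto simp: R_image)
  have Rn_sub: "Rn n x a \<subseteq> R x a" if "x \<in> X" "a \<in> A" for n x a
    using net[OF that, of n] by (auto simp: R_image Rn_image net_def)
  have Rn_close: "\<exists>P'\<in>Rn n x a. l1_dist X P P' \<le> 1 / real (Suc n)"
    if "x \<in> X" "a \<in> A" "P \<in> R x a" for n x a P
    using net[OF that(1,2), of n] that(3) unfolding R_image Rn_image net_def by (fastforce intro: less_imp_le)
  have Rn_ne: "Rn n x a \<noteq> {}" if "x \<in> X" "a \<in> A" for n x a
    using Rn_close[OF that] R_ne[OF that] by blast
  have R_compact: "compactin (weak_topology X) (R x a)" if "x \<in> X" "a \<in> A" for x a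
  proof -
    have "continuous_map (top_of_set (\<Theta> x a)) (weak_topology X) (Phat x a)"
      using prob[OF that] mass[OF that] by (intro continuous_map_weak_topology[OF fin]) auto
    moreover have "compactin (top_of_set (\<Theta> x a)) (\<Theta> x a)"
      using assms(8)[OF that] by (simp add: compactin_subtopology)
    ultimately show ?thesis
      unfolding R_image by (rule image_compactin[rotated])
  qed
  \<comment> \<open>A finite set of points in a Euclidean space is discrete, so the openness
    conditions in both kinds of hemicontinuity hold for any set-valued map on
    \<open>X \<times> A\<close>.\<close>
  have discrete: "openin (top_of_set (X \<times> A)) S" if "S \<subseteq> X \<times> A" for S
  proof -
    have "finite (X \<times> A - S)" using fin assms(3) by simp
    then have "closed (X \<times> A - S)" by (rule finite_imp_closed)
    moreover have "S = (X \<times> A) \<inter> - (X \<times> A - S)" using that by blast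
    ultimately show ?thesis by (metis open_Compl openin_open_Int)
  qed
  have uhc: "upper_hemicontinuous_map (top_of_set (X \<times> A)) (weak_topology X) (\<lambda>(x, a). R x a)"
    unfolding upper_hemicontinuous_map_def
    using R_prob by (auto simp: topspace_weak_topology intro!: discrete)
  have lhc: "lower_hemicontinuous_map (top_of_set (X \<times> A)) (weak_topology X) (\<lambda>(x, a). R x a)"
    unfolding lower_hemicontinuous_map_def
    using R_prob by (auto simp: topspace_weak_topology intro!: discrete)
  have approx: "\<exists>Pn :: nat \<Rightarrow> (real ^ 'd) measure. (\<forall>n. Pn n \<in> Rn n x a \<and> Rn n x a \<subseteq> R x a) \<and>
      limitin (weak_topology X) Pn P sequentially \<and>
      (\<lambda>n. \<integral>y. norm y \<partial>Pn n) \<longlonglongrightarrow> (\<integral>y. norm y \<partial>P)"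
    if xa: "x \<in> X" "a \<in> A" and P: "P \<in> R x a" for x a P
  proof -
    \<comment> \<open>Picking a net point within \<open>1 / (n + 1)\<close> of \<open>P\<close> for
      each \<open>n\<close> makes all point masses converge. Weak convergence and convergence of
      first moments both follow, the latter since the moment is a finite sum over
      \<open>X\<close>.\<close>
    obtain Pn where Pn: "\<And>n. Pn n \<in> Rn n x a" "\<And>n. l1_dist X P (Pn n) \<le> 1 / real (Suc n)"
      using Rn_close[OF xa P] by metis
    have Pnp: "Pn n \<in> prob_measures X" for n using Pn(1) Rn_sub[OF xa] R_prob[OF xa] by blast
    have Pp: "P \<in> prob_measures X" using P R_prob[OF xa] by blast
    have "(\<lambda>n. l1_dist X P (Pn n)) \<longlonglongrightarrow> 0"
    proof (rule tendsto_sandwich[OF _ _ tendsto_const LIMSEQ_Suc[OF lim_1_over_n]])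
      show "\<forall>\<^sub>F n in sequentially. 0 \<le> l1_dist X P (Pn n)" by (simp add: l1_dist_def sum_nonneg)
      show "\<forall>\<^sub>F n in sequentially. l1_dist X P (Pn n) \<le> 1 / of_nat (Suc n)" using Pn(2) by simp
    qed
    then have c: "(\<lambda>n. measure (Pn n) {y}) \<longlonglongrightarrow> measure P {y}" if "y \<in> X" for y
      using that by (intro tendsto_l1_dist_zero_imp_point_mass[OF fin])
    have "(\<lambda>n. \<integral>y. norm y \<partial>Pn n) \<longlonglongrightarrow> (\<integral>y. norm y \<partial>P)"
      unfolding integral_prob_measures[OF fin Pnp] integral_prob_measures[OF fin Pp]
      by (intro tendsto_intros c)
    then show ?thesis
      using Pn(1) Rn_sub[OF xa] limitin_weak_topology[OF fin Pnp Pp c] by blast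
  qed

  \<comment> \<open>The limit of the one-step robust expectations\<close>
  define M where "M = Max ((\<lambda>(x, a, y). \<bar>r x a y\<bar>) ` (X \<times> A \<times> X))"
  have M: "\<bar>r x a y\<bar> \<le> M" if "x \<in> X" "a \<in> A" "y \<in> X" for x a y
    unfolding M_def using that fin assms(3) by (intro Max_ge) force+
  \<comment> \<open>The constant of \<open>robust_value_approx\<close> without its factor
    \<open>\<eta>\<close>, which is \<open>1 / (n + 1)\<close> here.\<close>
  define C where "C = M / (1 - \<alpha>)\<^sup>2"
  have val: "V x \<le> Vn n x" "Vn n x \<le> V x + C * (1 / real (Suc n))" "\<bar>V x\<bar> \<le> M / (1 - \<alpha>)"
    if x: "x \<in> X" for n x
  proof -
    have sub: "Rn n x a \<noteq> {} \<and> Rn n x a \<subseteq> R x a" if "x \<in> X" "a \<in> A" for x a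
      using Rn_ne[OF that] Rn_sub[OF that] by blast
    note * = robust_value_approx[where r=r and R=R and R'="Rn n",
        OF fin \<open>A \<noteq> {}\<close> \<open>0 < \<alpha>\<close> \<open>\<alpha> < 1\<close> M R_prob sub Rn_close x]
    show "V x \<le> Vn n x" "\<bar>V x\<bar> \<le> M / (1 - \<alpha>)"
      using *(1,3) by (simp_all add: V_def Vn_def)
    show "Vn n x \<le> V x + C * (1 / real (Suc n))"
      using *(2) by (simp add: V_def Vn_def C_def mult.commute)
  qed
  have conv: "(\<lambda>n. INF P \<in> Rn n x a. \<integral>y. r x a y + \<alpha> * Vn n y \<partial>P)
      \<longlonglongrightarrow> (INF P \<in> R x a. \<integral>y. r x a y + \<alpha> * V y \<partial>P)" (is "?f \<longlonglongrightarrow> ?L")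
    if xa: "x \<in> X" "a \<in> A" for x a
  proof -
    \<comment> \<open>Reward bound plus discounted value bound; \<open>B\<close> controls the effect
      of moving \<open>P\<close> to a net point.\<close>
    define B where "B = M + \<alpha> * (M / (1 - \<alpha>))"
    have B: "\<bar>r x a y + \<alpha> * V y\<bar> \<le> B" if "y \<in> X" for y
    proof -
      have "\<bar>\<alpha> * V y\<bar> \<le> \<alpha> * (M / (1 - \<alpha>))"
        using mult_left_mono[OF val(3)[OF that], of \<alpha>] \<open>0 < \<alpha>\<close> by (simp add: abs_mult)
      then show ?thesis using M[OF xa that] unfolding B_def by linarith
    qed
    have mono: "(\<integral>y. f y \<partial>P) \<le> (\<integral>y. g y \<partial>P)"
      if "P \<in> R x a" "\<And>y. y \<in> X \<Longrightarrow> f y \<le> g y" for f g :: "real ^ 'd \<Rightarrow> real" and P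
    proof -
      have P: "P \<in> prob_measures X" using that R_prob[OF xa] by blast
      show ?thesis unfolding integral_prob_measures[OF fin P]
        using that(2) by (intro sum_mono mult_right_mono) auto
    qed
    have const: "(\<integral>y. f y + c \<partial>P) = (\<integral>y. f y \<partial>P) + c"
      if "P \<in> R x a" for f :: "real ^ 'd \<Rightarrow> real" and c P
    proof -
      have P: "P \<in> prob_measures X" using that R_prob[OF xa] by blast
      show ?thesis unfolding integral_prob_measures[OF fin P]
        using sum_measure_prob_measures[OF fin P]
        by (simp add: distrib_right sum.distrib sum_distrib_left[symmetric])
    qed
    have bV: "- B \<le> (\<integral>y. r x a y + \<alpha> * V y \<partial>P)" if "P \<in> R x a" for P
    proof -
      have "(\<integral>y. 0 + - B \<partial>P) \<le> (\<integral>y. r x a y + \<alpha> * V y \<partial>P)"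
        by (rule mono[OF that], drule B) linarith
      then show ?thesis unfolding const[OF that] by simp
    qed
    have bdd: "bdd_below ((\<lambda>P. \<integral>y. r x a y + \<alpha> * V y \<partial>P) ` R x a)"
      using bV by (rule bdd_belowI2)
    have VVn: "(\<integral>y. r x a y + \<alpha> * V y \<partial>P) \<le> (\<integral>y. r x a y + \<alpha> * Vn n y \<partial>P)"
      if "P \<in> R x a" for P n
      using val(1) \<open>0 < \<alpha>\<close> by (intro mono[OF that]) simp
    \<comment> \<open>Two effects of the same sign: the infimum runs over a smaller set, and the
      integrand is larger because \<open>V \<le> Vn n\<close>.\<close>
    have lower: "?L \<le> ?f n" for n
      by (rule cINF_superset_mono[OF Rn_ne[OF xa] bdd Rn_sub[OF xa] VVn])
    \<comment> \<open>The error has two sources: \<open>\<alpha> * C\<close> from replacing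
      \<open>Vn n\<close> by \<open>V\<close>, and \<open>B\<close> from replacing \<open>P\<close>
      by a net point \<open>P'\<close>.\<close>
    have upper: "?f n \<le> ?L + (B + \<alpha> * C) * (1 / real (Suc n))" for n
    proof -
      let ?e = "1 / real (Suc n)"
      have bddn: "bdd_below ((\<lambda>P. \<integral>y. r x a y + \<alpha> * Vn n y \<partial>P) ` Rn n x a)"
        using order_trans[OF bV VVn] Rn_sub[OF xa] by (intro bdd_belowI2) blast
      have "?f n - (B + \<alpha> * C) * ?e \<le> ?L"
      proof (rule cINF_greatest[OF R_ne[OF xa]])
        fix P assume P: "P \<in> R x a"
        obtain P' where P': "P' \<in> Rn n x a" "l1_dist X P P' \<le> ?e"
          using Rn_close[OF xa P] by blast
        have P'R: "P' \<in> R x a" using P' Rn_sub[OF xa] by blast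
        have "?f n \<le> (\<integral>y. r x a y + \<alpha> * Vn n y \<partial>P')"
          by (rule cINF_lower[OF bddn P'(1)])
        also have "\<dots> \<le> (\<integral>y. (r x a y + \<alpha> * V y) + \<alpha> * C * ?e \<partial>P')"
        proof (rule mono[OF P'R])
          fix y assume "y \<in> X"
          from mult_left_mono[OF val(2)[OF this, of n], of \<alpha>] \<open>0 < \<alpha>\<close>
          show "r x a y + \<alpha> * Vn n y \<le> (r x a y + \<alpha> * V y) + \<alpha> * C * ?e"
            by (simp add: algebra_simps)
        qed
        also have "\<dots> = (\<integral>y. r x a y + \<alpha> * V y \<partial>P') + \<alpha> * C * ?e"
          by (rule const[OF P'R])
        finally have 1: "?f n \<le> (\<integral>y. r x a y + \<alpha> * V y \<partial>P') + \<alpha> * C * ?e" .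
        have "B \<ge> 0" using B[OF xa(1)] by linarith
        then have "B * l1_dist X P P' \<le> B * ?e" using P'(2) by (intro mult_left_mono)
        moreover have "\<bar>(\<integral>y. r x a y + \<alpha> * V y \<partial>P) - (\<integral>y. r x a y + \<alpha> * V y \<partial>P')\<bar> \<le> B * l1_dist X P P'"
          using P P'R R_prob[OF xa] B by (intro abs_integral_diff_le_l1_dist[OF fin]) auto
        ultimately show "?f n - (B + \<alpha> * C) * ?e \<le> (\<integral>y. r x a y + \<alpha> * V y \<partial>P)"
          using 1 unfolding distrib_right by linarith
      qed
      then show ?thesis by linarith
    qed
    have "(\<lambda>n. ?L + (B + \<alpha> * C) * (1 / real (Suc n))) \<longlonglongrightarrow> ?L + (B + \<alpha> * C) * 0"
      by (intro tendsto_intros LIMSEQ_Suc[OF lim_1_over_n])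
    then show ?thesis
      using lower upper by (intro tendsto_sandwich[OF _ _ tendsto_const, of ?L ?f]) auto
  qed
  show ?thesis
    unfolding Let_def
    using net R_ne R_compact uhc lhc approx conv
    by (intro exI[of _ \<Theta>n])
      (simp add: R_def[symmetric] Rn_def[symmetric] V_def[symmetric] Vn_def[symmetric] net_def)
qed

end
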